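(* Let $p\in H^\infty\cap C(\overline{\mathbb D})$ and let $\lambda\in\mathbb C$ be a complex number that is not in the essential spectrum of the Bergman-space Toeplitz operator $T_{\overline{z}+p}$. Then $\lambda$ is an eigenvalue of $T_{\overline{z}+p}$ if and only if either the function $1+z[p(z)-\lambda]$ has no zeros in the open unit disk $\mathbb D$, or $1+z[p(z)-\lambda]$ has finitely many zeros $z_1,\dots,z_k$ in $\mathbb D$, all of them simple, which satisfy $$z_j^2p'(z_j)=\frac{n_j+2}{n_j+1}$$ for some integer $n_j\in\{0,1,2,\dots\}$, for each $j=1,\dots,k$.
   Context: $\mathbb D$ is the open unit disk in $\mathbb C$, $dA$ is Lebesgue area measure on $\mathbb D$ normalized so that $A(\mathbb D)=1$. The Bergman space $L^2_a$ is the closed subspace of $L^2(\mathbb D,dA)$ consisting of functions analytic on $\mathbb D$, and $P$ is the orthogonal projection of $L^2(\mathbb D,dA)$ onto $L^2_a$. For $\varphi\in L^\infty(\mathbb D,dA)$, the Toeplitz operator $T_\varphi$ on $L^2_a$ is $T_\varphi f=P(\varphi f)$. $H^\infty\cap C(\overline{\mathbb D})$ is the disk algebra (bounded analytic functions on $\mathbb D$ extending continuously to $\overline{\mathbb D}$). The essential spectrum of an operator $T$ is the set of $\lambda$ for which $T-\lambda I$ is not Fredholm. *)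

theory Defs
  imports "HOL-Analysis.Analysis"
begin

definition dA :: "complex measure" where
  "dA = scale_measure (ennreal (1 / pi)) (restrict_space lborel (ball 0 1))"

definition L2D :: "(complex \<Rightarrow> complex) set" where
  "L2D = {f. f \<in> borel_measurable dA \<and> integrable dA (\<lambda>z. (cmod (f z))\<^sup>2)}"

definition L2inner :: "(complex \<Rightarrow> complex) \<Rightarrow> (complex \<Rightarrow> complex) \<Rightarrow> complex" where
  "L2inner f g = integral\<^sup>L dA (\<lambda>z. f z * cnj (g z))"

definition L2norm :: "(complex \<Rightarrow> complex) \<Rightarrow> real" where
  "L2norm f = sqrt (integral\<^sup>L dA (\<lambda>z. (cmod (f z))\<^sup>2))"

text \<open>Bergman space: analytic functions on D in L^2; normalized to vanish off D.\<close>
definition bergman :: "(complex \<Rightarrow> complex) set" where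
  "bergman = {f \<in> L2D. f holomorphic_on ball 0 1 \<and> (\<forall>z. z \<notin> ball 0 1 \<longrightarrow> f z = 0)}"

definition bergman_proj :: "(complex \<Rightarrow> complex) \<Rightarrow> (complex \<Rightarrow> complex)" where
  "bergman_proj g = (THE h. h \<in> bergman \<and> (\<forall>k\<in>bergman. L2inner (\<lambda>z. g z - h z) k = 0))"

definition toeplitz :: "(complex \<Rightarrow> complex) \<Rightarrow> (complex \<Rightarrow> complex) \<Rightarrow> (complex \<Rightarrow> complex)" where
  "toeplitz \<phi> f = bergman_proj (\<lambda>z. \<phi> z * f z)"

text \<open>Fredholmness of T - l I on the Bergman space: closed range, finite-dimensional
  kernel, range of finite codimension.\<close>
definition fredholm_on_bergman ::
  "((complex \<Rightarrow> complex) \<Rightarrow> (complex \<Rightarrow> complex)) \<Rightarrow> complex \<Rightarrow> bool" where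
  "fredholm_on_bergman T l \<longleftrightarrow>
     (\<exists>n::nat. \<exists>b::nat \<Rightarrow> complex \<Rightarrow> complex. (\<forall>i<n. b i \<in> bergman) \<and>
        (\<forall>f\<in>bergman. (\<forall>z\<in>ball 0 1. T f z - l * f z = 0) \<longrightarrow>
           (\<exists>c::nat \<Rightarrow> complex. \<forall>z\<in>ball 0 1. f z = (\<Sum>i<n. c i * b i z)))) \<and>
     (\<exists>n::nat. \<exists>b::nat \<Rightarrow> complex \<Rightarrow> complex. (\<forall>i<n. b i \<in> bergman) \<and>
        (\<forall>g\<in>bergman. \<exists>f\<in>bergman. \<exists>c::nat \<Rightarrow> complex.
           \<forall>z\<in>ball 0 1. g z = T f z - l * f z + (\<Sum>i<n. c i * b i z))) \<and>
     (\<forall>(fs::nat \<Rightarrow> complex \<Rightarrow> complex) g. (\<forall>m. fs m \<in> bergman) \<longrightarrow> g \<in> bergman \<longrightarrow>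
        (\<lambda>m. L2norm (\<lambda>z. T (fs m) z - l * fs m z - g z)) \<longlonglongrightarrow> 0 \<longrightarrow>
        (\<exists>f\<in>bergman. \<forall>z\<in>ball 0 1. T f z - l * f z = g z))"

definition essential_spectrum_bergman ::
  "((complex \<Rightarrow> complex) \<Rightarrow> (complex \<Rightarrow> complex)) \<Rightarrow> complex set" where
  "essential_spectrum_bergman T = {l. \<not> fredholm_on_bergman T l}"

definition eigenvalue_bergman ::
  "((complex \<Rightarrow> complex) \<Rightarrow> (complex \<Rightarrow> complex)) \<Rightarrow> complex \<Rightarrow> bool" where
  "eigenvalue_bergman T l \<longleftrightarrow>
     (\<exists>f\<in>bergman. (\<exists>z\<in>ball 0 1. f z \<noteq> 0) \<and> (\<forall>z\<in>ball 0 1. T f z = l * f z))"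

end

theory Submission
  imports Defs "HOL-Probability.Distribution_Functions" "HOL-Complex_Analysis.Complex_Analysis"
    "HOL-Real_Asymp.Real_Asymp"
begin

text \<open>
  Expanding in Taylor series shows that the operator with symbol \<open>cnj z\<close> sends \<open>f = F'\<close> with
  \<open>F(0) = 0\<close> to \<open>(z f - F) / z\<^sup>2\<close>. The eigenvalue equation is therefore the first order equation
  \<open>z q F' = F\<close> with \<open>q = 1 + z (p - l)\<close>. At a zero \<open>w\<close> of \<open>q\<close> a nonzero holomorphic solution must
  vanish to some order \<open>n \<ge> 1\<close>, and comparing leading terms gives \<open>n w q'(w) = 1\<close>, which is the
  stated condition. Conversely, if all residues of \<open>1 / (z q)\<close> in the disk are positive integers,
  then \<open>exp (\<integral> 1 / (z q))\<close> is a holomorphic solution.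

  Fredholmness enters through \<open>q \<noteq> 0\<close> on the unit circle, which makes the zeros finite in number
  and the solution bounded. If \<open>q(\<zeta>) = 0\<close> with \<open>\<bar>\<zeta>\<bar> = 1\<close>, the normalised powers of the
  peaking function \<open>(1 + cnj \<zeta> z) / 2\<close> tend weakly to zero and are almost annihilated by the adjoint
  operator. Given any finite-dimensional space \<open>V\<close>, a rapidly convergent series of them lies outside
  the sum of \<open>V\<close> and the range, so the range has infinite codimension.
\<close>

section \<open>Area measure on the disk\<close>

text \<open>Since \<open>bergman_proj\<close> is a definite description, a projection can only be
  evaluated by exhibiting a Bergman function with the right inner products. This is why the operator
  is computed on Taylor coefficients, and why areas, moments and Parseval are developed first.
  Termwise integration is justified on disks of radius r < 1, where power series converge
  absolutely; statements on the whole disk are limits as r tends to 1. The Fredholm part is a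
  comparison of two geometric rates. The test functions \<open>h n\<close> are chosen so that every
  element of the range plus V pairs with \<open>h n\<close> in size at most C / 16^n, where C
  depends on that element only. The series with terms \<open>h k\<close> / 4^k pairs with
  \<open>h n\<close> in size about 1 / 4^n, because the cross terms are also of order 1 / 16^n. No
  constant C reconciles the two. In the differential equation the coefficient s = z q has one zero
  more than q, namely the origin. There s'(0) = 1, so the vanishing order forced on F is 1, in
  agreement with F(0) = 0, and no condition arises. The integer n_j of the theorem is the vanishing
  order minus one.\<close>

lemma lborel_complex_eq_distr:
  "(lborel :: complex measure) = distr (lborel \<Otimes>\<^sub>M lborel) borel (\<lambda>(x, y). Complex x y)"
proof (rule lborel_eqI)
  fix l u :: complex
  assume le: "\<And>b. b \<in> Basis \<Longrightarrow> l \<bullet> b \<le> u \<bullet> b"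
  have le': "Re l \<le> Re u" "Im l \<le> Im u"
    using le[of 1] le[of \<i>] by (auto simp: Basis_complex_def)
  have "emeasure (distr (lborel \<Otimes>\<^sub>M lborel) borel (\<lambda>(x, y). Complex x y)) (box l u) =
      emeasure (lborel \<Otimes>\<^sub>M lborel) ((\<lambda>(x, y). Complex x y) -` box l u)"
    by (subst emeasure_distr) (auto simp: space_pair_measure Complex_eq split_def)
  also have "(\<lambda>(x, y). Complex x y) -` box l u = box (Re l) (Re u) \<times> box (Im l) (Im u)"
    by (auto simp: in_box_complex_iff box_real)
  also have "emeasure (lborel \<Otimes>\<^sub>M lborel) \<dots> = (\<Prod>b\<in>Basis. (u - l) \<bullet> b)"
    using le' by (subst lborel.emeasure_pair_measure_Times)
      (auto simp: Basis_complex_def ennreal_mult)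
  finally show "emeasure (distr (lborel \<Otimes>\<^sub>M lborel) borel (\<lambda>(x, y). Complex x y)) (box l u) =
      (\<Prod>b\<in>Basis. (u - l) \<bullet> b)" .
qed simp

text \<open>Both orders of integration are kept because a shear is a translation in one coordinate
  with the other one frozen, and the moving coordinate has to be integrated first.\<close>

lemma nn_integral_lborel_complex:
  assumes [measurable]: "f \<in> borel_measurable borel"
  shows "(\<integral>\<^sup>+z. f z \<partial>lborel) = (\<integral>\<^sup>+x. \<integral>\<^sup>+y. f (Complex x y) \<partial>lborel \<partial>lborel)"
    and "(\<integral>\<^sup>+z. f z \<partial>lborel) = (\<integral>\<^sup>+y. \<integral>\<^sup>+x. f (Complex x y) \<partial>lborel \<partial>lborel)"
proof -
  have eq: "(\<integral>\<^sup>+z. f z \<partial>lborel) = (\<integral>\<^sup>+p. f (Complex (fst p) (snd p)) \<partial>(lborel \<Otimes>\<^sub>M lborel))"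
    by (subst lborel_complex_eq_distr, subst nn_integral_distr) (auto simp: split_def Complex_eq)
  show "(\<integral>\<^sup>+z. f z \<partial>lborel) = (\<integral>\<^sup>+x. \<integral>\<^sup>+y. f (Complex x y) \<partial>lborel \<partial>lborel)"
    unfolding eq by (subst lborel.nn_integral_fst[symmetric]) (auto simp: Complex_eq)
  show "(\<integral>\<^sup>+z. f z \<partial>lborel) = (\<integral>\<^sup>+y. \<integral>\<^sup>+x. f (Complex x y) \<partial>lborel \<partial>lborel)"
    unfolding eq by (subst lborel_pair.nn_integral_snd[symmetric]) (auto simp: Complex_eq split_def)
qed

lemma nn_integral_shear_Re:
  fixes f :: "complex \<Rightarrow> ennreal" and t :: real
  assumes [measurable]: "f \<in> borel_measurable borel"
  shows "(\<integral>\<^sup>+z. f (z + t * Im z) \<partial>lborel) = (\<integral>\<^sup>+z. f z \<partial>lborel)"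
proof -
  have "(\<integral>\<^sup>+x. f (Complex x y) \<partial>lborel) = (\<integral>\<^sup>+x. f (Complex x y + t * Im (Complex x y)) \<partial>lborel)" for y
    by (subst nn_integral_real_affine[where c = 1 and t = "t * y"])
      (auto simp: Complex_eq algebra_simps)
  then show ?thesis
    by (simp add: nn_integral_lborel_complex(2))
qed

lemma nn_integral_shear_Im:
  fixes f :: "complex \<Rightarrow> ennreal" and t :: real
  assumes [measurable]: "f \<in> borel_measurable borel"
  shows "(\<integral>\<^sup>+z. f (z + \<i> * t * Re z) \<partial>lborel) = (\<integral>\<^sup>+z. f z \<partial>lborel)"
proof -
  have "(\<integral>\<^sup>+y. f (Complex x y) \<partial>lborel) = (\<integral>\<^sup>+y. f (Complex x y + \<i> * t * Re (Complex x y)) \<partial>lborel)" for x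
    by (subst nn_integral_real_affine[where c = 1 and t = "t * x"])
      (auto simp: Complex_eq algebra_simps)
  then show ?thesis
    by (simp add: nn_integral_lborel_complex(1))
qed

text \<open>A rotation is a product of three shears, and shears preserve area by Fubini.\<close>

lemma nn_integral_rotate:
  fixes f :: "complex \<Rightarrow> ennreal" and u :: complex
  assumes [measurable]: "f \<in> borel_measurable borel" and u: "cmod u = 1" "u \<noteq> -1"
  shows "(\<integral>\<^sup>+z. f (u * z) \<partial>lborel) = (\<integral>\<^sup>+z. f z \<partial>lborel)"
proof -
  \<comment> \<open>For u of angle \<theta>, t is minus the tangent of \<theta>/2, the classical
    parameter of the outer two shears; u \<noteq> -1 keeps it finite.\<close>
  define c s t where "c = Re u" and "s = Im u" and "t = - s / (1 + c)"
  have cs: "c\<^sup>2 + s\<^sup>2 = 1"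
    using u(1) by (simp add: c_def s_def cmod_def)
  have c: "1 + c \<noteq> 0"
  proof
    assume "1 + c = 0"
    then have "c = -1" by simp
    with cs have "u = -1" by (auto simp: c_def s_def complex_eq_iff)
    with u show False by simp
  qed
  have t1: "t * (1 + c) = - s" and t2: "1 + s * t = c"
  proof -
    show "t * (1 + c) = - s" using c by (simp add: t_def)
    have "(1 + s * t) * (1 + c) = (1 + c) - s\<^sup>2"
      using \<open>t * (1 + c) = - s\<close> by (simp add: algebra_simps power2_eq_square)
    also have "\<dots> = c * (1 + c)" using cs by (simp add: algebra_simps power2_eq_square)
    finally show "1 + s * t = c" using c by (simp only: mult_cancel_right) simp
  qed
  define S where "S = (\<lambda>z. z + complex_of_real t * Im z)"
  define R where "R = (\<lambda>z. z + \<i> * complex_of_real s * Re z)"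
  have [measurable]: "S \<in> borel_measurable borel" "R \<in> borel_measurable borel"
    unfolding S_def R_def by measurable
  have rot: "S (R (S z)) = u * z" for z
  proof (rule complex_eqI)
    have c': "c * Re z = Re z + s * t * Re z"
      by (simp add: t2[symmetric] distrib_right)
    have a: "Im (R (S z)) = s * Re z + (1 + s * t) * Im z"
      by (simp add: S_def R_def algebra_simps)
    then show "Im (S (R (S z))) = Im (u * z)"
      by (simp add: t2) (simp add: S_def c_def s_def)
    have "Re (S (R (S z))) = Re z + t * Im z + t * (s * Re z + (1 + s * t) * Im z)"
      by (simp add: S_def R_def algebra_simps)
    also have "\<dots> = (1 + s * t) * Re z + t * (1 + c) * Im z"
      using c' unfolding t2 by (simp add: algebra_simps)
    also have "\<dots> = Re (u * z)" unfolding t1 t2 by (simp add: c_def s_def)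
    finally show "Re (S (R (S z))) = Re (u * z)" .
  qed
  have "(\<integral>\<^sup>+z. f (u * z) \<partial>lborel) = (\<integral>\<^sup>+z. f (S (R (S z))) \<partial>lborel)"
    by (simp add: rot)
  also have "\<dots> = (\<integral>\<^sup>+z. f (S (R z)) \<partial>lborel)"
    using nn_integral_shear_Re[of "\<lambda>z. f (S (R z))" t] by (simp add: S_def)
  also have "\<dots> = (\<integral>\<^sup>+z. f (S z) \<partial>lborel)"
    using nn_integral_shear_Im[of "\<lambda>z. f (S z)" s] by (simp add: R_def)
  also have "\<dots> = (\<integral>\<^sup>+z. f z \<partial>lborel)"
    using nn_integral_shear_Re[of f t] by (simp add: S_def)
  finally show ?thesis .
qed

section \<open>The normalised area measure and the integrals of monomials\<close>

lemma space_dA [simp]: "space dA = ball 0 1"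
  by (simp add: dA_def space_scale_measure space_restrict_space)

lemma sets_dA: "sets dA = sets (restrict_space borel (ball 0 1))"
  by (simp add: dA_def sets_restrict_space)

lemma measurable_dA_iff: "f \<in> measurable dA M \<longleftrightarrow> f \<in> measurable (restrict_space borel (ball 0 1)) M"
  by (intro arg_cong2[where f = "(\<in>)"] measurable_cong_sets refl) (simp add: sets_dA)

lemma measurable_dA_I [measurable (raw)]: "f \<in> measurable borel M \<Longrightarrow> f \<in> measurable dA M"
  by (simp add: measurable_dA_iff measurable_restrict_space1)

lemma measurable_dA_continuous:
  fixes f :: "complex \<Rightarrow> 'a::topological_space"
  shows "continuous_on (ball 0 1) f \<Longrightarrow> f \<in> borel_measurable dA"
  by (simp add: measurable_dA_iff borel_measurable_continuous_on_restrict)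

lemma nn_integral_dA:
  assumes "f \<in> borel_measurable dA"
  shows "(\<integral>\<^sup>+z. f z \<partial>dA) = ennreal (1 / pi) * (\<integral>\<^sup>+z. f z * indicator (ball 0 1) z \<partial>lborel)"
  using assms unfolding dA_def
  by (subst nn_integral_scale_measure)
    (auto simp: nn_integral_restrict_space cong: measurable_cong_sets)

lemma emeasure_dA:
  assumes "A \<in> sets borel" "A \<subseteq> ball 0 1"
  shows "emeasure dA A = ennreal (1 / pi) * emeasure lborel A"
  using assms by (simp add: dA_def emeasure_restrict_space)

lemma emeasure_dA_ball:
  assumes "0 \<le> r" "r \<le> 1"
  shows "emeasure dA (ball 0 r) = ennreal (r\<^sup>2)"
  using assms by (subst emeasure_dA)
    (auto simp: emeasure_ball unit_ball_vol_2 simp flip: ennreal_mult)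

lemma finite_measure_dA: "finite_measure dA"
  using emeasure_dA_ball[of 1] by (intro finite_measureI) simp

interpretation dA: finite_measure dA
  by (rule finite_measure_dA)

lemma measure_dA_ball_1: "measure dA (ball 0 1) = 1"
  by (rule measure_eq_emeasure_eq_ennreal) (simp_all add: emeasure_dA_ball)

lemma distr_dA_rotate:
  assumes u: "cmod u = 1" "u \<noteq> -1"
  shows "distr dA dA (\<lambda>z. u * z) = dA"
proof (rule measure_eqI)
  have meas [measurable]: "(\<lambda>z. u * z) \<in> measurable dA dA"
    unfolding measurable_cong_sets[OF sets_dA sets_dA]
    by (intro measurable_restrict_space3) (auto simp: norm_mult u)
  fix A assume "A \<in> sets (distr dA dA (\<lambda>z. u * z))"
  then have A: "A \<in> sets dA" by simp
  then have A': "A \<in> sets borel" "A \<subseteq> ball 0 1"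
    by (auto simp: sets_dA sets_restrict_space_iff)
  note [measurable] = A'(1)
  have "emeasure (distr dA dA (\<lambda>z. u * z)) A = (\<integral>\<^sup>+z. indicator A z \<partial>distr dA dA (\<lambda>z. u * z))"
    using A by simp
  also have "\<dots> = (\<integral>\<^sup>+z. indicator A (u * z) \<partial>dA)"
    using A by (subst nn_integral_distr) auto
  also have "\<dots> = ennreal (1 / pi) * (\<integral>\<^sup>+z. indicator A (u * z) * indicator (ball 0 1) z \<partial>lborel)"
    by (subst nn_integral_dA) auto
  also have "(\<integral>\<^sup>+z. indicator A (u * z) * indicator (ball 0 1) z \<partial>lborel) = (\<integral>\<^sup>+z. indicator A (u * z) \<partial>lborel)"
    using A'(2) u(1) by (intro nn_integral_cong) (auto simp: indicator_def norm_mult dest!: subsetD)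
  also have "\<dots> = (\<integral>\<^sup>+z. indicator A z \<partial>lborel)"
    using nn_integral_rotate[OF _ u, of "indicator A"] by simp
  also have "ennreal (1 / pi) * \<dots> = emeasure dA A"
    using A' by (simp add: emeasure_dA)
  finally show "emeasure (distr dA dA (\<lambda>z. u * z)) A = emeasure dA A" .
qed simp

lemma integral_dA_rotate:
  fixes f :: "complex \<Rightarrow> complex"
  assumes "cmod u = 1" "u \<noteq> -1" and f: "f \<in> borel_measurable dA"
  shows "(\<integral>z. f (u * z) \<partial>dA) = (\<integral>z. f z \<partial>dA)"
proof -
  have "(\<lambda>z. u * z) \<in> measurable dA dA"
    unfolding measurable_cong_sets[OF sets_dA sets_dA]
    by (intro measurable_restrict_space3) (auto simp: norm_mult assms)
  then have "(\<integral>z. f (u * z) \<partial>dA) = (\<integral>z. f z \<partial>distr dA dA (\<lambda>z. u * z))"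
    using f by (subst integral_distr) auto
  then show ?thesis by (simp add: distr_dA_rotate assms)
qed

text \<open>A rotation by u leaves the integral I unchanged but multiplies the integrand by
  \<open>u ^ n * cnj u ^ m\<close>. One rotation for which this factor is the imaginary unit gives I
  = \<i> I, hence I = 0.\<close>

lemma integral_disk_monomials_orthogonal:
  assumes "n \<noteq> m"
  shows "(\<integral>z. indicator (ball 0 r) z *\<^sub>R (z ^ n * cnj z ^ m) \<partial>dA) = 0"
proof -
  define d where "d = real n - real m"
  have d: "\<bar>d\<bar> \<ge> 1" using assms by (auto simp: d_def)
  \<comment> \<open>This angle times n - m is a right angle. As n - m is a nonzero integer, the
    angle itself is at most a right angle in size, so u avoids the value -1 excluded by the rotation
    lemma.\<close>
  define u where "u = cis (pi / (2 * d))"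
  have "\<bar>pi / (2 * d)\<bar> \<le> pi / 2"
    using d by (simp add: abs_mult divide_simps)
  then have "Re u \<ge> 0" unfolding u_def cis.sel abs_le_iff by (intro cos_ge_zero) linarith+
  then have "u \<noteq> -1" by auto
  moreover have "cmod u = 1" by (simp add: u_def)
  ultimately have u: "cmod u = 1" "u \<noteq> -1" by simp_all
  have "u ^ n * cnj u ^ m = cis (n * (pi / (2 * d)) + m * - (pi / (2 * d)))"
    unfolding u_def cis_cnj Complex.DeMoivre cis_mult ..
  also have "n * (pi / (2 * d)) + m * - (pi / (2 * d)) = d * (pi / (2 * d))"
    by (simp only: d_def left_diff_distrib mult_minus_right add_uminus_conv_diff)
  also have "\<dots> = pi / 2"
    using d by auto
  finally have ui: "u ^ n * cnj u ^ m = \<i>" by simp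
  let ?f = "\<lambda>z. indicator (ball 0 r) z *\<^sub>R (z ^ n * cnj z ^ m)"
  have [measurable]: "?f \<in> borel_measurable dA"
    by (intro measurable_dA_I borel_measurable_scaleR borel_measurable_indicator
        borel_measurable_continuous_onI continuous_intros) auto
  have "(\<integral>z. ?f z \<partial>dA) = (\<integral>z. ?f (u * z) \<partial>dA)"
    by (rule integral_dA_rotate[symmetric]) (use u in auto)
  also have "\<dots> = (\<integral>z. \<i> * ?f z \<partial>dA)"
    unfolding ui[symmetric]
    by (intro Bochner_Integration.integral_cong refl)
      (auto simp: indicator_def norm_mult u power_mult_distrib)
  also have "\<dots> = \<i> * (\<integral>z. ?f z \<partial>dA)" by (rule integral_mult_right_zero)
  finally have "(1 - \<i>) * (\<integral>z. ?f z \<partial>dA) = 0"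
    unfolding left_diff_distrib by (simp only: mult_1 diff_self)
  moreover have "1 - \<i> \<noteq> 0" by (simp add: complex_eq_iff)
  ultimately show ?thesis unfolding mult_eq_0_iff by blast
qed

text \<open>The disk of radius sqrt x has normalised area x, so the squared modulus is uniformly
  distributed. This law plays the part of polar coordinates in radial integrals.\<close>

lemma distr_dA_norm_square: "distr dA borel (\<lambda>z. (cmod z)\<^sup>2) = uniform_measure lborel {0..1}"
proof (rule cdf_unique')
  show "finite_borel_measure (distr dA borel (\<lambda>z. (cmod z)\<^sup>2))"
    by (simp add: finite_borel_measure_def finite_borel_measure_axioms_def dA.finite_measure_distr)
  have "prob_space (uniform_measure lborel {0..1::real})"
    by (rule prob_space_uniform_measure) auto
  then show "finite_borel_measure (uniform_measure lborel {0..1::real})"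
    by (simp add: finite_borel_measure_def finite_borel_measure_axioms_def prob_space_def)
  show "cdf (distr dA borel (\<lambda>z. (cmod z)\<^sup>2)) = cdf (uniform_measure lborel {0..1})"
  proof
    fix x :: real
    have "measure dA {z \<in> ball 0 1. (cmod z)\<^sup>2 \<le> x} = measure lborel ({0..1} \<inter> {..x})"
    proof -
      consider "x < 0" | "0 \<le> x" "x < 1" | "x \<ge> 1" by linarith
      then show ?thesis
      proof cases
        case 1
        then have "{z \<in> ball 0 1. (cmod z)\<^sup>2 \<le> x} = {}" "{0..1} \<inter> {..x} = {}"
          by (auto simp: not_le intro: less_le_trans)
        then show ?thesis by (simp only: measure_empty)
      next
        case 2
        have iff: "(cmod z)\<^sup>2 \<le> x \<longleftrightarrow> cmod z \<le> sqrt x" for z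
          using real_sqrt_le_iff[of "(cmod z)\<^sup>2" x] by simp
        have "sqrt x < 1" using 2 by simp
        have eq: "{z \<in> ball 0 1. (cmod z)\<^sup>2 \<le> x} = cball 0 (sqrt x)"
          unfolding iff using le_less_trans[OF _ \<open>sqrt x < 1\<close>] by (auto simp del: real_sqrt_lt_1_iff)
        then have "cball 0 (sqrt x) \<subseteq> ball (0 :: complex) 1" by blast
        then have "emeasure dA (cball 0 (sqrt x)) = ennreal x"
          using 2 by (subst emeasure_dA)
            (auto simp: emeasure_cball unit_ball_vol_2 simp flip: ennreal_mult)
        then have "measure dA (cball 0 (sqrt x)) = x"
          using 2 by (intro measure_eq_emeasure_eq_ennreal)
        moreover have "{0..1} \<inter> {..x} = {0..x}" using 2 by auto
        ultimately show ?thesis using 2(1) by (simp only: eq) simp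
      next
        case 3
        have "(cmod z)\<^sup>2 \<le> x" if "cmod z < 1" for z
        proof -
          have "(cmod z)\<^sup>2 \<le> 1" using that by (simp add: power_le_one)
          then show ?thesis using 3 by simp
        qed
        then have "{z \<in> ball 0 1. (cmod z)\<^sup>2 \<le> x} = ball 0 1" "{0..1} \<inter> {..x} = {0..1}"
          using 3 by auto
        then show ?thesis by (simp only: measure_dA_ball_1) simp
      qed
    qed
    moreover have "cdf (distr dA borel (\<lambda>z. (cmod z)\<^sup>2)) x = measure dA {z \<in> ball 0 1. (cmod z)\<^sup>2 \<le> x}"
      unfolding cdf_def by (subst measure_distr) (auto intro!: arg_cong[where f = "measure dA"])
    moreover have "cdf (uniform_measure lborel {0..1}) x = measure lborel ({0..1} \<inter> {..x})"
      unfolding cdf_def by (subst measure_uniform_measure) auto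
    ultimately show "cdf (distr dA borel (\<lambda>z. (cmod z)\<^sup>2)) x = cdf (uniform_measure lborel {0..1}) x"
      by (simp only:)
  qed
qed

text \<open>The integrand depends on the squared modulus alone, so the uniform law turns the
  integral into that of t^n over [0, r^2].\<close>

lemma integral_disk_monomial_norm:
  assumes "0 \<le> r" "r \<le> 1"
  shows "(\<integral>z. indicator (ball 0 r) z *\<^sub>R (z ^ n * cnj z ^ n) \<partial>dA) = of_real (r ^ (2 * n + 2) / (n + 1))"
proof -
  let ?g = "\<lambda>t::real. indicator {..<r\<^sup>2} t * t ^ n"
  have "cmod z < r \<longleftrightarrow> (cmod z)\<^sup>2 < r\<^sup>2" for z
    using assms by (metis norm_ge_zero power2_less_imp_less power_strict_mono zero_less_numeral)
  moreover have mono: "z ^ n * cnj z ^ n = of_real ((cmod z)\<^sup>2) ^ n" for z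
    by (subst complex_norm_square) (simp add: power_mult_distrib)
  ultimately have "(\<integral>z. indicator (ball 0 r) z *\<^sub>R (z ^ n * cnj z ^ n) \<partial>dA) = (\<integral>z. of_real (?g ((cmod z)\<^sup>2)) \<partial>dA)"
    by (intro Bochner_Integration.integral_cong refl)
      (auto simp: indicator_def mono)
  also have "\<dots> = of_real (\<integral>z. ?g ((cmod z)\<^sup>2) \<partial>dA)"
    by (rule integral_complex_of_real)
  finally have eq: "(\<integral>z. indicator (ball 0 r) z *\<^sub>R (z ^ n * cnj z ^ n) \<partial>dA) =
    of_real (\<integral>z. ?g ((cmod z)\<^sup>2) \<partial>dA)" .
  have "(\<integral>z. ?g ((cmod z)\<^sup>2) \<partial>dA) = (\<integral>t. ?g t \<partial>uniform_measure lborel {0..1})"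
    unfolding distr_dA_norm_square[symmetric] by (subst integral_distr) auto
  also have "\<dots> = (\<integral>t. indicator {0..1} t * ?g t \<partial>lborel)"
  proof -
    have "uniform_measure lborel {0..1::real} = density lborel (\<lambda>t. ennreal (indicator {0..1} t))"
      by (simp add: uniform_measure_def ennreal_indicator divide_ennreal_def)
    then show ?thesis
      by (simp only:) (subst integral_density, auto)
  qed
  \<comment> \<open>The open disk gives a half-open range of t; adding its endpoint r^2 changes a
    null set and gives the closed interval wanted by the fundamental theorem.\<close>
  also have "\<dots> = (\<integral>t. t ^ n * indicator {0..r\<^sup>2} t \<partial>lborel)"
  proof (rule integral_cong_AE)
    have "r\<^sup>2 \<le> 1" using assms by (simp add: power_le_one)
    then show "AE t in lborel. indicator {0..1} t * ?g t = t ^ n * indicator {0..r\<^sup>2} t"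
      using AE_lborel_singleton[of "r\<^sup>2"] by (auto simp: indicator_def elim!: eventually_mono)
  qed auto
  also have "\<dots> = (r\<^sup>2) ^ Suc n / Suc n - 0 ^ Suc n / Suc n"
  proof (rule integral_FTC_Icc_real)
    fix t :: real
    show "((\<lambda>t. t ^ Suc n / Suc n) has_real_derivative t ^ n) (at t)"
      using DERIV_cdivide[OF DERIV_pow[of "Suc n" t], of "real (Suc n)"] by (simp del: of_nat_Suc power_Suc)
  qed (auto intro!: continuous_intros)
  finally have int: "(\<integral>z. ?g ((cmod z)\<^sup>2) \<partial>dA) = (r\<^sup>2) ^ Suc n / Suc n - 0 ^ Suc n / Suc n" .
  have "(r\<^sup>2) ^ Suc n = r ^ (2 * n + 2)"
    unfolding power_mult[symmetric] by (rule arg_cong[where f = "power r"]) simp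
  then have "(r\<^sup>2) ^ Suc n / Suc n = r ^ (2 * n + 2) / Suc n"
    by (rule arg_cong)
  then have "(r\<^sup>2) ^ Suc n / Suc n - 0 ^ Suc n / Suc n = r ^ (2 * n + 2) / (n + 1)"
    by (simp del: power_Suc)
  with int have "(\<integral>z. ?g ((cmod z)\<^sup>2) \<partial>dA) = r ^ (2 * n + 2) / (n + 1)"
    by (rule trans)
  with eq show ?thesis by metis
qed

section \<open>Power series and Parseval's identity on disks\<close>

lemma indicator_ball_measurable_dA [measurable]:
  "(\<lambda>z. indicator (ball 0 r) z :: real) \<in> borel_measurable dA"
  by (intro measurable_dA_I borel_measurable_indicator) auto

lemma powser_abs_summable:
  fixes a :: "nat \<Rightarrow> complex"
  assumes "\<And>z. z \<in> ball 0 1 \<Longrightarrow> (\<lambda>n. a n * z ^ n) sums f z" and r: "0 \<le> r" "r < 1"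
  shows "summable (\<lambda>n. cmod (a n) * r ^ n)"
proof -
  define s where "s = (r + 1) / 2"
  have s: "r < s" "s < 1" using r by (auto simp: s_def)
  have "summable (\<lambda>n. a n * of_real s ^ n)"
    using assms(1)[of "of_real s"] s r by (auto simp: sums_iff)
  then have "summable (\<lambda>n. norm (a n * of_real r ^ n))"
    by (rule powser_insidea) (use s r in auto)
  then show ?thesis using r by (simp add: norm_mult norm_power)
qed

lemma holomorphic_on_powser:
  fixes a :: "nat \<Rightarrow> complex"
  assumes f: "\<And>z. z \<in> ball 0 1 \<Longrightarrow> (\<lambda>n. a n * z ^ n) sums f z"
  shows "f holomorphic_on ball 0 1"
  by (rule power_series_holomorphic[where z = 0 and r = 1 and a = a]) (use f in auto)

text \<open>Termwise integration leaves only the m-th term, by orthogonality. It is allowed because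
  the terms are dominated by \<open>cmod (a n) * r ^ n\<close>, which is summable for r < 1.\<close>

lemma integral_disk_monomial:
  assumes f: "\<And>z. z \<in> ball 0 1 \<Longrightarrow> (\<lambda>n. a n * z ^ n) sums f z" and r: "0 \<le> r" "r < 1"
  shows "(\<integral>z. indicator (ball 0 r) z *\<^sub>R (f z * cnj z ^ m) \<partial>dA) = a m * of_real (r ^ (2 * m + 2) / (m + 1))"
proof -
  define F where "F = (\<lambda>n z. indicator (ball 0 r) z *\<^sub>R (a n * z ^ n * cnj z ^ m))"
  have meas [measurable]: "F n \<in> borel_measurable dA" for n
    unfolding F_def by (intro borel_measurable_scaleR indicator_ball_measurable_dA measurable_dA_I
        borel_measurable_continuous_onI continuous_intros)
  have bound: "cmod (F n z) \<le> cmod (a n) * r ^ n" if "z \<in> ball 0 1" for n z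
  proof -
    have "cmod z ^ m \<le> 1" using that by (intro power_le_one) auto
    moreover have "cmod z ^ n \<le> r ^ n" if "cmod z < r" using that by (intro power_mono) auto
    ultimately have "cmod z ^ n * cmod z ^ m \<le> r ^ n * 1" if "cmod z < r"
      using that r by (intro mult_mono) auto
    then show ?thesis
      using r by (auto simp: F_def indicator_def norm_mult norm_power mult.assoc intro!: mult_left_mono)
  qed
  have int: "integrable dA (F n)" for n
    by (rule dA.integrable_const_bound[OF AE_I2[OF bound] meas]) simp
  have sum: "summable (\<lambda>n. cmod (a n) * r ^ n)"
    by (rule powser_abs_summable[OF f r])
  have "summable (\<lambda>n. cmod (F n z))" if "z \<in> ball 0 1" for z
    by (rule summable_comparison_test'[OF sum]) (use bound[OF that] in auto)
  moreover have "(\<integral>z. cmod (F n z) \<partial>dA) \<le> cmod (a n) * r ^ n" for n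
  proof -
    have "(\<integral>z. cmod (F n z) \<partial>dA) \<le> (\<integral>z. cmod (a n) * r ^ n \<partial>dA)"
      by (intro integral_mono integrable_norm int bound) simp_all
    also have "\<dots> = cmod (a n) * r ^ n" by (simp add: measure_dA_ball_1)
    finally show ?thesis .
  qed
  then have "summable (\<lambda>n. \<integral>z. cmod (F n z) \<partial>dA)"
    by (intro summable_comparison_test'[OF sum]) auto
  ultimately have "(\<lambda>n. integral\<^sup>L dA (F n)) sums (\<integral>z. (\<Sum>n. F n z) \<partial>dA)"
    by (intro sums_integral int) auto
  moreover have "(\<integral>z. (\<Sum>n. F n z) \<partial>dA) = (\<integral>z. indicator (ball 0 r) z *\<^sub>R (f z * cnj z ^ m) \<partial>dA)"
  proof (intro Bochner_Integration.integral_cong refl)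
    fix z assume "z \<in> space dA"
    then have "(\<lambda>n. F n z) sums (indicator (ball 0 r) z *\<^sub>R (f z * cnj z ^ m))"
      unfolding F_def by (intro sums_scaleR_right sums_mult2 f) auto
    then show "(\<Sum>n. F n z) = indicator (ball 0 r) z *\<^sub>R (f z * cnj z ^ m)"
      by (simp add: sums_iff)
  qed
  moreover have "integral\<^sup>L dA (F n) = (if n = m then a m * of_real (r ^ (2 * m + 2) / (m + 1)) else 0)" for n
  proof -
    have "integral\<^sup>L dA (F n) = (\<integral>z. a n * (indicator (ball 0 r) z *\<^sub>R (z ^ n * cnj z ^ m)) \<partial>dA)"
      unfolding F_def by (intro Bochner_Integration.integral_cong refl) simp
    also have "\<dots> = a n * (\<integral>z. indicator (ball 0 r) z *\<^sub>R (z ^ n * cnj z ^ m) \<partial>dA)"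
      by (rule integral_mult_right_zero)
    finally show ?thesis
      using r by (simp add: integral_disk_monomials_orthogonal integral_disk_monomial_norm del: of_real_divide)
  qed
  then have "(\<lambda>n. integral\<^sup>L dA (F n)) sums (a m * of_real (r ^ (2 * m + 2) / (m + 1)))"
    using sums_single[of m "\<lambda>m. a m * of_real (r ^ (2 * m + 2) / (m + 1))"] by (simp cong: if_cong)
  ultimately show ?thesis
    by (metis sums_unique2)
qed

text \<open>Only g is expanded; f stays whole and is bounded by M on the disk of radius r. Each term
  is then an integral of f against a conjugate monomial, already known, and double series do not
  arise.\<close>

lemma parseval_disk:
  assumes f: "\<And>z. z \<in> ball 0 1 \<Longrightarrow> (\<lambda>n. a n * z ^ n) sums f z"
    and g: "\<And>z. z \<in> ball 0 1 \<Longrightarrow> (\<lambda>n. b n * z ^ n) sums g z" and r: "0 \<le> r" "r < 1"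
  shows "(\<lambda>n. a n * cnj (b n) * of_real (r ^ (2 * n + 2) / (n + 1))) sums
           (\<integral>z. indicator (ball 0 r) z *\<^sub>R (f z * cnj (g z)) \<partial>dA)"
proof -
  define M where "M = (\<Sum>n. cmod (a n) * r ^ n)"
  have fM: "cmod (f z) \<le> M" if "z \<in> ball 0 r" for z
  proof -
    have z: "z \<in> ball 0 1" using that r by auto
    have "cmod (a n * z ^ n) \<le> cmod (a n) * r ^ n" for n
      using that by (auto simp: norm_mult norm_power intro!: mult_left_mono power_mono)
    then have "cmod (\<Sum>n. a n * z ^ n) \<le> M"
      unfolding M_def by (intro norm_suminf_le powser_abs_summable[OF f r])
    then show ?thesis using f[OF z] by (simp add: sums_iff)
  qed
  have M0: "0 \<le> M"
    unfolding M_def using r by (intro suminf_nonneg powser_abs_summable[OF f r]) auto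
  have [measurable]: "f \<in> borel_measurable dA"
    by (intro measurable_dA_continuous holomorphic_on_imp_continuous_on holomorphic_on_powser[OF f])
  define F where "F = (\<lambda>n z. indicator (ball 0 r) z *\<^sub>R (f z * cnj (b n * z ^ n)))"
  have meas [measurable]: "F n \<in> borel_measurable dA" for n
    unfolding F_def by (intro borel_measurable_scaleR borel_measurable_times indicator_ball_measurable_dA)
      (auto intro!: measurable_dA_I borel_measurable_continuous_onI continuous_intros)
  have bound: "cmod (F n z) \<le> M * (cmod (b n) * r ^ n)" if "z \<in> ball 0 1" for n z
    using r M0 fM[of z] by (auto simp: F_def indicator_def norm_mult norm_power
          intro!: mult_mono power_mono)
  have int: "integrable dA (F n)" for n
    by (rule dA.integrable_const_bound[OF AE_I2[OF bound] meas]) simp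
  have sum: "summable (\<lambda>n. M * (cmod (b n) * r ^ n))"
    by (intro summable_mult powser_abs_summable[OF g r])
  have "summable (\<lambda>n. cmod (F n z))" if "z \<in> ball 0 1" for z
    by (rule summable_comparison_test'[OF sum]) (use bound[OF that] in auto)
  moreover have "(\<integral>z. cmod (F n z) \<partial>dA) \<le> M * (cmod (b n) * r ^ n)" for n
  proof -
    have "(\<integral>z. cmod (F n z) \<partial>dA) \<le> (\<integral>z. M * (cmod (b n) * r ^ n) \<partial>dA)"
      by (intro integral_mono integrable_norm int bound) simp_all
    also have "\<dots> = M * (cmod (b n) * r ^ n)" by (simp add: measure_dA_ball_1)
    finally show ?thesis .
  qed
  then have "summable (\<lambda>n. \<integral>z. cmod (F n z) \<partial>dA)"
    by (intro summable_comparison_test'[OF sum]) auto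
  ultimately have "(\<lambda>n. integral\<^sup>L dA (F n)) sums (\<integral>z. (\<Sum>n. F n z) \<partial>dA)"
    by (intro sums_integral int) auto
  moreover have "(\<integral>z. (\<Sum>n. F n z) \<partial>dA) = (\<integral>z. indicator (ball 0 r) z *\<^sub>R (f z * cnj (g z)) \<partial>dA)"
  proof (intro Bochner_Integration.integral_cong refl)
    fix z assume "z \<in> space dA"
    then have "(\<lambda>n. F n z) sums (indicator (ball 0 r) z *\<^sub>R (f z * cnj (g z)))"
      unfolding F_def by (intro sums_scaleR_right sums_mult sums_cnj[THEN iffD2] g) auto
    then show "(\<Sum>n. F n z) = indicator (ball 0 r) z *\<^sub>R (f z * cnj (g z))"
      by (simp add: sums_iff)
  qed
  moreover have "integral\<^sup>L dA (F n) = a n * cnj (b n) * of_real (r ^ (2 * n + 2) / (n + 1))" for n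
  proof -
    have "integral\<^sup>L dA (F n) = (\<integral>z. cnj (b n) * (indicator (ball 0 r) z *\<^sub>R (f z * cnj z ^ n)) \<partial>dA)"
      unfolding F_def by (intro Bochner_Integration.integral_cong refl) (simp add: mult_ac)
    also have "\<dots> = cnj (b n) * (\<integral>z. indicator (ball 0 r) z *\<^sub>R (f z * cnj z ^ n) \<partial>dA)"
      by (rule integral_mult_right_zero)
    also have "\<dots> = a n * cnj (b n) * of_real (r ^ (2 * n + 2) / (n + 1))"
      by (subst integral_disk_monomial[OF f r]) simp_all
    finally show ?thesis .
  qed
  ultimately show ?thesis by simp
qed

section \<open>The Toeplitz operator on Taylor series\<close>

definition taylor_coeff :: "(complex \<Rightarrow> complex) \<Rightarrow> nat \<Rightarrow> complex" where
  "taylor_coeff f n = (deriv ^^ n) f 0 / fact n"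

lemma taylor_sums:
  assumes "f holomorphic_on ball 0 1" "z \<in> ball 0 1"
  shows "(\<lambda>n. taylor_coeff f n * z ^ n) sums f z"
  using holomorphic_power_series[OF assms] by (simp add: taylor_coeff_def)

text \<open>\<open>backshift\<close> is the Toeplitz operator with symbol \<open>cnj z\<close>.\<close>

definition backshift_coeff :: "(complex \<Rightarrow> complex) \<Rightarrow> nat \<Rightarrow> complex" where
  "backshift_coeff f n = of_nat (n + 1) / of_nat (n + 2) * taylor_coeff f (Suc n)"

definition backshift :: "(complex \<Rightarrow> complex) \<Rightarrow> complex \<Rightarrow> complex" where
  "backshift f z = (if z \<in> ball 0 1 then \<Sum>n. backshift_coeff f n * z ^ n else 0)"

lemma cmod_backshift_factor: "cmod (of_nat (n + 1) / of_nat (n + 2)) = real (n + 1) / real (n + 2)"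
  by (simp only: norm_divide norm_of_nat)

lemma backshift_sums:
  assumes "f holomorphic_on ball 0 1" "z \<in> ball 0 1"
  shows "(\<lambda>n. backshift_coeff f n * z ^ n) sums backshift f z"
proof -
  have "(\<lambda>n. taylor_coeff f (Suc n) * w ^ n) sums (\<Sum>n. taylor_coeff f (Suc n) * w ^ n)"
    if "w \<in> ball 0 1" for w
    using taylor_sums[OF assms(1) that] summable_powser_split_head[of "taylor_coeff f" w]
    by (auto simp: sums_iff)
  then have "summable (\<lambda>n. cmod (taylor_coeff f (Suc n)) * cmod z ^ n)"
    by (rule powser_abs_summable) (use assms in auto)
  moreover have "cmod (backshift_coeff f n * z ^ n) \<le> cmod (taylor_coeff f (Suc n)) * cmod z ^ n" for n
    unfolding backshift_coeff_def norm_mult norm_power cmod_backshift_factor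
    by (intro mult_right_mono mult_left_le_one_le) auto
  ultimately have "summable (\<lambda>n. backshift_coeff f n * z ^ n)"
    by (rule summable_comparison_test')
  then show ?thesis using assms(2) by (simp add: backshift_def summable_sums)
qed

lemma backshift_holomorphic:
  assumes "f holomorphic_on ball 0 1"
  shows "backshift f holomorphic_on ball 0 1"
  by (rule holomorphic_on_powser[OF backshift_sums[OF assms]])

lemma holomorphic_measurable_dA:
  "f holomorphic_on ball 0 1 \<Longrightarrow> f \<in> borel_measurable dA"
  by (intro measurable_dA_continuous holomorphic_on_imp_continuous_on)

lemma holomorphic_square_integrable_disk:
  assumes f: "f holomorphic_on ball 0 1" and r: "0 \<le> r" "r < 1"
  shows "integrable dA (\<lambda>z. indicator (ball 0 r) z * (cmod (f z))\<^sup>2)"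
proof -
  have "compact (f ` cball 0 r)"
    using r by (intro compact_continuous_image continuous_on_subset[OF holomorphic_on_imp_continuous_on[OF f]]) auto
  then obtain M where M: "\<And>z. z \<in> cball 0 r \<Longrightarrow> cmod (f z) \<le> M"
    using compact_imp_bounded bounded_iff by (metis imageI)
  note [measurable] = holomorphic_measurable_dA[OF f]
  have "(cmod (f z))\<^sup>2 \<le> M\<^sup>2" if "cmod z < r" for z
    using M[of z] that by (intro power_mono) auto
  then show ?thesis
    by (intro dA.integrable_const_bound[where B = "M\<^sup>2"]) (auto simp: indicator_def)
qed

lemma parseval_disk_norm:
  assumes f: "\<And>z. z \<in> ball 0 1 \<Longrightarrow> (\<lambda>n. a n * z ^ n) sums f z" and r: "0 \<le> r" "r < 1"
  shows "(\<lambda>n. (cmod (a n))\<^sup>2 * (r ^ (2 * n + 2) / (n + 1))) sums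
           (\<integral>z. indicator (ball 0 r) z * (cmod (f z))\<^sup>2 \<partial>dA)"
proof -
  have "indicator (ball 0 r) z *\<^sub>R (f z * cnj (f z)) = of_real (indicator (ball 0 r) z * (cmod (f z))\<^sup>2)" for z
    by (simp add: complex_norm_square[symmetric] scaleR_conv_of_real)
  then have "(\<integral>z. indicator (ball 0 r) z *\<^sub>R (f z * cnj (f z)) \<partial>dA) =
      of_real (\<integral>z. indicator (ball 0 r) z * (cmod (f z))\<^sup>2 \<partial>dA)"
    by (simp only: integral_complex_of_real)
  moreover have "a n * cnj (a n) * of_real (r ^ (2 * n + 2) / (n + 1)) =
      of_real ((cmod (a n))\<^sup>2 * (r ^ (2 * n + 2) / (n + 1)))" for n
    by (simp only: complex_norm_square[symmetric] of_real_mult)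
  ultimately show ?thesis
    using parseval_disk[OF f f r] by (simp only: sums_of_real_iff)
qed

text \<open>Radii increasing to 1, as a sequence so that the convergence theorems apply. They start
  at 1/2 so that factors r^2 can be divided out with a uniform constant.\<close>

definition disk_radius :: "nat \<Rightarrow> real" where
  "disk_radius i = 1 - 1 / (real i + 2)"

lemma disk_radius: "1 / 2 \<le> disk_radius i" "0 \<le> disk_radius i" "disk_radius i < 1"
  "mono disk_radius" "disk_radius \<longlonglongrightarrow> 1"
proof -
  have "1 / (real i + 2) \<le> 1 / 2" for i by (intro divide_left_mono) auto
  then show "1 / 2 \<le> disk_radius i" for i by (simp add: disk_radius_def)
  from this[of i] show "0 \<le> disk_radius i" by simp
  show "disk_radius i < 1" by (simp add: disk_radius_def)
  show "mono disk_radius"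
    by (auto simp: mono_def disk_radius_def intro!: divide_left_mono)
  have "(\<lambda>i. 1 - 1 / (real i + 2)) \<longlonglongrightarrow> 1 - 0"
    by (intro tendsto_diff tendsto_const) real_asymp
  then show "disk_radius \<longlonglongrightarrow> 1" by (simp add: disk_radius_def[abs_def])
qed

lemma indicator_disk_radius_tendsto:
  fixes z :: complex
  assumes "z \<in> ball 0 1"
  shows "(\<lambda>i. indicator (ball 0 (disk_radius i)) z :: real) \<longlonglongrightarrow> 1"
proof -
  have "eventually (\<lambda>i. cmod z < disk_radius i) sequentially"
    using assms by (intro order_tendstoD(1)[OF disk_radius(5)]) simp
  then have "eventually (\<lambda>i. indicator (ball 0 (disk_radius i)) z = (1::real)) sequentially"
    by eventually_elim (auto simp: indicator_def)
  then show ?thesis by (rule tendsto_eventually)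
qed

text \<open>Monotone convergence along \<open>disk_radius\<close>. The bound is asked only for r
  \<ge> 1/2, the range in which estimates that lose a factor 1 / r^2 stay uniform.\<close>

lemma square_integrable_if_bounded_on_disks:
  assumes f: "f holomorphic_on ball 0 1"
    and C: "\<And>r. 1 / 2 \<le> r \<Longrightarrow> r < 1 \<Longrightarrow> (\<integral>z. indicator (ball 0 r) z * (cmod (f z))\<^sup>2 \<partial>dA) \<le> C"
  shows "integrable dA (\<lambda>z. (cmod (f z))\<^sup>2)"
proof -
  define I where "I = (\<lambda>i. \<integral>z. indicator (ball 0 (disk_radius i)) z * (cmod (f z))\<^sup>2 \<partial>dA)"
  have int: "integrable dA (\<lambda>z. indicator (ball 0 (disk_radius i)) z * (cmod (f z))\<^sup>2)" for i
    by (rule holomorphic_square_integrable_disk[OF f disk_radius(2,3)])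
  have le: "indicator (ball 0 (disk_radius i)) z * (cmod (f z))\<^sup>2 \<le>
      indicator (ball 0 (disk_radius j)) z * (cmod (f z))\<^sup>2" if "i \<le> j" for i j z
    using monoD[OF disk_radius(4) that] by (auto simp: indicator_def)
  have "incseq I"
    unfolding I_def by (intro monoI integral_mono int le)
  moreover have "\<And>i. I i \<le> C" unfolding I_def by (intro C disk_radius)
  ultimately obtain L where L: "I \<longlonglongrightarrow> L" by (metis incseq_convergent)
  note [measurable] = holomorphic_measurable_dA[OF f]
  show ?thesis
  proof (rule integral_monotone_convergence_nonneg(1)[OF int, where x = L])
    show "AE z in dA. mono (\<lambda>i. indicator (ball 0 (disk_radius i)) z * (cmod (f z))\<^sup>2)"
      by (auto intro!: monoI le)
    show "AE z in dA. (\<lambda>i. indicator (ball 0 (disk_radius i)) z * (cmod (f z))\<^sup>2) \<longlonglongrightarrow> (cmod (f z))\<^sup>2"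
    proof (rule AE_I2)
      fix z assume "z \<in> space dA"
      then show "(\<lambda>i. indicator (ball 0 (disk_radius i)) z * (cmod (f z))\<^sup>2) \<longlonglongrightarrow> (cmod (f z))\<^sup>2"
        using tendsto_mult_right[OF indicator_disk_radius_tendsto[of z], of "(cmod (f z))\<^sup>2"] by simp
    qed
    show "(\<lambda>i. \<integral>z. indicator (ball 0 (disk_radius i)) z * (cmod (f z))\<^sup>2 \<partial>dA) \<longlonglongrightarrow> L"
      using L by (simp add: I_def)
  qed auto
qed

lemma bergmanD:
  assumes "f \<in> bergman"
  shows "f holomorphic_on ball 0 1" "integrable dA (\<lambda>z. (cmod (f z))\<^sup>2)" "f \<in> borel_measurable dA" "f \<in> L2D"
    "\<And>z. z \<notin> ball 0 1 \<Longrightarrow> f z = 0"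
  using assms by (auto simp: bergman_def L2D_def)

lemma bergmanI:
  assumes "f holomorphic_on ball 0 1" "integrable dA (\<lambda>z. (cmod (f z))\<^sup>2)"
    "\<And>z. z \<notin> ball 0 1 \<Longrightarrow> f z = 0"
  shows "f \<in> bergman"
  using assms by (auto simp: bergman_def L2D_def holomorphic_measurable_dA)

text \<open>Square integrability is read off from coefficients: by Parseval on smaller disks, the
  n-th term for \<open>backshift f\<close> is controlled by term n + 1 for f.\<close>

lemma backshift_bergman:
  assumes "f \<in> bergman"
  shows "backshift f \<in> bergman"
proof (rule bergmanI)
  note f = bergmanD[OF assms]
  show "backshift f holomorphic_on ball 0 1" by (rule backshift_holomorphic[OF f(1)])
  show "\<And>z. z \<notin> ball 0 1 \<Longrightarrow> backshift f z = 0" by (auto simp: backshift_def)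
  show "integrable dA (\<lambda>z. (cmod (backshift f z))\<^sup>2)"
  proof (rule square_integrable_if_bounded_on_disks[OF \<open>backshift f holomorphic_on ball 0 1\<close>])
    fix r :: real assume r: "1 / 2 \<le> r" "r < 1"
    let ?b = "\<lambda>n. (cmod (backshift_coeff f n))\<^sup>2 * (r ^ (2 * n + 2) / (n + 1))"
    let ?a = "\<lambda>n. (cmod (taylor_coeff f n))\<^sup>2 * (r ^ (2 * n + 2) / (n + 1))"
    let ?I = "\<lambda>f. \<integral>z. indicator (ball 0 r) z * (cmod (f z))\<^sup>2 \<partial>dA"
    have b: "?b sums ?I (backshift f)"
      by (rule parseval_disk_norm) (use r backshift_sums[OF f(1)] in auto)
    have a: "?a sums ?I f"
      by (rule parseval_disk_norm) (use r taylor_sums[OF f(1)] in auto)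
    \<comment> \<open>The shift of index costs a factor 1 / r^2, at most 4 for r \<ge> 1/2. The
      weights cause no further loss, since (n + 1) / (n + 2)^2 \<le> 1 / (n + 2).\<close>
    have le: "?b n \<le> 4 * ?a (Suc n)" for n
    proof -
      have "?b n = (real (n + 1) / real (n + 2))\<^sup>2 / (n + 1) * ((cmod (taylor_coeff f (Suc n)))\<^sup>2 * r ^ (2 * n + 2))"
        unfolding backshift_coeff_def norm_mult cmod_backshift_factor power_mult_distrib by simp
      also have "\<dots> \<le> 1 / (n + 2) * ((cmod (taylor_coeff f (Suc n)))\<^sup>2 * (4 * r ^ (2 * Suc n + 2)))"
      proof (intro mult_mono mult_left_mono)
        show "(real (n + 1) / real (n + 2))\<^sup>2 / (n + 1) \<le> 1 / (n + 2)"
        proof -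
          have "(real (n + 1) / real (n + 2))\<^sup>2 / (n + 1) = (real (n + 1) / real (n + 2)) * (1 / (n + 2))"
            by (simp add: power2_eq_square)
          also have "\<dots> \<le> 1 / (n + 2)"
            by (rule mult_left_le_one_le) auto
          finally show ?thesis .
        qed
        have "(1 / 2) * (1 / 2) \<le> r * r" using r by (intro mult_mono) auto
        then have "1 \<le> 4 * r\<^sup>2" by (simp add: power2_eq_square)
        then have "r ^ (2 * n + 2) * 1 \<le> r ^ (2 * n + 2) * (4 * r\<^sup>2)"
          using r by (intro mult_left_mono) auto
        then show "r ^ (2 * n + 2) \<le> 4 * r ^ (2 * Suc n + 2)"
          by (simp add: power_add power2_eq_square mult_ac)
      qed (use r in auto)
      also have "\<dots> = 4 * ?a (Suc n)" by simp
      finally show ?thesis .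
    qed
    have a': "(\<lambda>n. ?a (Suc n)) sums (?I f - ?a 0)"
      using a by (subst sums_Suc_iff) simp
    have "?I (backshift f) \<le> 4 * (?I f - ?a 0)"
      by (rule sums_le[OF le b sums_mult[OF a']])
    also have "\<dots> \<le> 4 * ?I f" using r by simp
    also have "\<dots> \<le> 4 * (\<integral>z. (cmod (f z))\<^sup>2 \<partial>dA)"
      by (intro mult_left_mono integral_mono holomorphic_square_integrable_disk f)
        (use r in \<open>auto simp: indicator_def\<close>)
    finally show "?I (backshift f) \<le> 4 * (\<integral>z. (cmod (f z))\<^sup>2 \<partial>dA)" .
  qed
qed

lemma emeasure_dA_open_pos:
  assumes "open U" "U \<subseteq> ball 0 1" "U \<noteq> {}"
  shows "0 < emeasure dA U"
proof -
  obtain x where "x \<in> U" using assms by auto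
  then obtain e where e: "e > 0" "ball x e \<subseteq> U"
    using assms(1) openE by blast
  have "0 < emeasure lborel (ball x e)"
    using e by (simp add: emeasure_ball unit_ball_vol_2)
  also have "\<dots> \<le> emeasure lborel U"
    using e assms(1) by (intro emeasure_mono) auto
  finally show ?thesis
    using assms by (simp add: emeasure_dA ennreal_zero_less_mult_iff)
qed

text \<open>Turns equality in L^2 into pointwise equality: the set where f is nonzero is open, and a
  nonempty open set has positive area.\<close>

lemma eq_zero_if_AE_dA:
  fixes f :: "complex \<Rightarrow> complex"
  assumes f: "continuous_on (ball 0 1) f" and ae: "AE z in dA. f z = 0" and z: "z \<in> ball 0 1"
  shows "f z = 0"
proof (rule ccontr)
  assume "f z \<noteq> 0"
  define U where "U = {z \<in> ball 0 1. f z \<noteq> 0}"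
  have "open (ball 0 1 \<inter> f -` (- {0}))"
    by (rule continuous_open_preimage[OF f open_ball]) auto
  also have "ball 0 1 \<inter> f -` (- {0}) = U" by (auto simp: U_def)
  finally have "open U" .
  then have U: "0 < emeasure dA U"
    using \<open>f z \<noteq> 0\<close> z by (intro emeasure_dA_open_pos) (auto simp: U_def)
  have [measurable]: "f \<in> borel_measurable dA" by (rule measurable_dA_continuous[OF f])
  have eq: "{z \<in> space dA. \<not> f z = 0} = U" by (auto simp: U_def)
  have "{z \<in> space dA. \<not> f z = 0} \<in> sets dA" by measurable
  then have "emeasure dA U = 0"
    using ae AE_iff_measurable[OF _ eq] unfolding eq by blast
  with U show False by simp
qed

lemma cnj_measurable [measurable]: "cnj \<in> borel_measurable borel"
  by (intro borel_measurable_continuous_onI continuous_intros)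

lemma L2D_inner_integrable:
  assumes "f \<in> L2D" "g \<in> L2D"
  shows "integrable dA (\<lambda>z. f z * cnj (g z))"
proof (rule Bochner_Integration.integrable_bound)
  have [measurable]: "f \<in> borel_measurable dA" "g \<in> borel_measurable dA"
    using assms by (auto simp: L2D_def)
  show "integrable dA (\<lambda>z. (cmod (f z))\<^sup>2 + (cmod (g z))\<^sup>2)"
    using assms by (auto simp: L2D_def)
  show "(\<lambda>z. f z * cnj (g z)) \<in> borel_measurable dA" by measurable
  have "x * y \<le> x\<^sup>2 + y\<^sup>2" for x y :: real
  proof -
    have "0 \<le> (x - y)\<^sup>2 + x\<^sup>2 + y\<^sup>2" by simp
    then have "2 * (x * y) \<le> 2 * (x\<^sup>2 + y\<^sup>2)" by (simp add: power2_diff algebra_simps)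
    then show ?thesis by simp
  qed
  then show "AE z in dA. norm (f z * cnj (g z)) \<le> norm ((cmod (f z))\<^sup>2 + (cmod (g z))\<^sup>2)"
    by (simp add: norm_mult)
qed

lemma L2D_bounded_mult:
  assumes f: "f \<in> L2D" and g: "g \<in> borel_measurable dA" and B: "\<And>z. z \<in> ball 0 1 \<Longrightarrow> cmod (g z) \<le> B"
  shows "(\<lambda>z. g z * f z) \<in> L2D"
proof -
  have [measurable]: "f \<in> borel_measurable dA" using f by (auto simp: L2D_def)
  note [measurable] = g
  have "integrable dA (\<lambda>z. (cmod (g z * f z))\<^sup>2)"
  proof (rule Bochner_Integration.integrable_bound)
    show "integrable dA (\<lambda>z. B\<^sup>2 * (cmod (f z))\<^sup>2)" using f by (auto simp: L2D_def)
    show "AE z in dA. norm ((cmod (g z * f z))\<^sup>2) \<le> norm (B\<^sup>2 * (cmod (f z))\<^sup>2)"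
      using B by (intro AE_I2) (auto simp: norm_mult power_mult_distrib intro!: mult_right_mono power_mono)
  qed measurable
  then show ?thesis by (simp add: L2D_def)
qed

lemma bergman_diff:
  assumes f: "f \<in> bergman" and g: "g \<in> bergman"
  shows "(\<lambda>z. f z - g z) \<in> bergman"
proof (rule bergmanI)
  note f' = bergmanD[OF f] and g' = bergmanD[OF g]
  note [measurable] = f'(3) g'(3)
  show "integrable dA (\<lambda>z. (cmod (f z - g z))\<^sup>2)"
  proof (rule Bochner_Integration.integrable_bound)
    show "integrable dA (\<lambda>z. 2 * ((cmod (f z))\<^sup>2 + (cmod (g z))\<^sup>2))"
      using f' g' by auto
    have "(cmod (f z - g z))\<^sup>2 \<le> 2 * ((cmod (f z))\<^sup>2 + (cmod (g z))\<^sup>2)" for z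
    proof -
      have "(cmod (f z - g z))\<^sup>2 \<le> (cmod (f z) + cmod (g z))\<^sup>2"
        by (intro power_mono norm_triangle_ineq4) auto
      also have "\<dots> \<le> (cmod (f z) + cmod (g z))\<^sup>2 + (cmod (f z) - cmod (g z))\<^sup>2" by simp
      also have "\<dots> = 2 * ((cmod (f z))\<^sup>2 + (cmod (g z))\<^sup>2)"
        by (simp add: power2_sum power2_diff algebra_simps)
      finally show ?thesis .
    qed
    then show "AE z in dA. norm ((cmod (f z - g z))\<^sup>2) \<le> norm (2 * ((cmod (f z))\<^sup>2 + (cmod (g z))\<^sup>2))"
      by simp
  qed measurable
qed (use bergmanD[OF f] bergmanD[OF g] in \<open>auto intro!: holomorphic_intros\<close>)

lemma L2inner_diff_left:
  assumes "f \<in> L2D" "g \<in> L2D" "k \<in> L2D"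
  shows "L2inner (\<lambda>z. f z - g z) k = L2inner f k - L2inner g k"
  unfolding L2inner_def left_diff_distrib
  by (intro Bochner_Integration.integral_diff L2D_inner_integrable assms)

text \<open>The way to evaluate the definite description: two candidates differ by a Bergman
  function d that is orthogonal to every Bergman function, in particular to itself, so d
  vanishes.\<close>

lemma bergman_proj_eqI:
  assumes g: "g \<in> L2D" and h: "h \<in> bergman" and orth: "\<And>k. k \<in> bergman \<Longrightarrow> L2inner g k = L2inner h k"
  shows "bergman_proj g = h"
  unfolding bergman_proj_def
proof (rule the_equality)
  show "h \<in> bergman \<and> (\<forall>k\<in>bergman. L2inner (\<lambda>z. g z - h z) k = 0)"
    using g h orth by (auto simp: L2inner_diff_left bergmanD)
next
  fix h' assume h': "h' \<in> bergman \<and> (\<forall>k\<in>bergman. L2inner (\<lambda>z. g z - h' z) k = 0)"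
  define d where "d = (\<lambda>z. h' z - h z)"
  have d: "d \<in> bergman" unfolding d_def using h h' by (intro bergman_diff) auto
  have "L2inner g d = L2inner h' d"
    using h' d g by (auto simp: L2inner_diff_left bergmanD)
  then have "L2inner d d = 0"
    using h h' d orth[OF d] by (simp add: d_def L2inner_diff_left bergmanD)
  also have "L2inner d d = of_real (\<integral>z. (cmod (d z))\<^sup>2 \<partial>dA)"
    unfolding L2inner_def complex_norm_square[symmetric] by (rule integral_complex_of_real)
  finally have "(\<integral>z. (cmod (d z))\<^sup>2 \<partial>dA) = 0" by simp
  then have "AE z in dA. (cmod (d z))\<^sup>2 = 0"
    using bergmanD(2)[OF d] by (subst (asm) integral_nonneg_eq_0_iff_AE) auto
  then have "AE z in dA. d z = 0" by simp
  then have "d z = 0" if "z \<in> ball 0 1" for z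
    using eq_zero_if_AE_dA[OF holomorphic_on_imp_continuous_on[OF bergmanD(1)[OF d]]] that by blast
  \<comment> \<open>Members of \<open>bergman\<close> are 0 off the disk, so agreement on the disk
    is equality of functions, as the definite description demands.\<close>
  then have "h' z = h z" for z
    using bergmanD(5)[OF h] bergmanD(5)[of h'] h' by (cases "z \<in> ball 0 1") (auto simp: d_def)
  then show "h' = h" by auto
qed

lemma L2D_cnj_mult: "f \<in> L2D \<Longrightarrow> (\<lambda>z. cnj z * f z) \<in> L2D"
  by (rule L2D_bounded_mult[where B = 1]) auto

text \<open>Carries identities from the smaller disks to the whole disk, by dominated
  convergence.\<close>

lemma integral_disks_tendsto:
  fixes F :: "complex \<Rightarrow> complex"
  assumes F: "integrable dA F"
  shows "(\<lambda>i. \<integral>z. indicator (ball 0 (disk_radius i)) z *\<^sub>R F z \<partial>dA) \<longlonglongrightarrow> integral\<^sup>L dA F"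
proof (rule integral_dominated_convergence[where w = "\<lambda>z. cmod (F z)"])
  have [measurable]: "F \<in> borel_measurable dA" using F by auto
  show "F \<in> borel_measurable dA" "integrable dA (\<lambda>z. cmod (F z))" using F by auto
  show "(\<lambda>z. indicator (ball 0 (disk_radius i)) z *\<^sub>R F z) \<in> borel_measurable dA" for i
    by (intro borel_measurable_scaleR indicator_ball_measurable_dA) measurable
  show "AE z in dA. (\<lambda>i. indicator (ball 0 (disk_radius i)) z *\<^sub>R F z) \<longlonglongrightarrow> F z"
  proof (rule AE_I2)
    fix z assume "z \<in> space dA"
    then show "(\<lambda>i. indicator (ball 0 (disk_radius i)) z *\<^sub>R F z) \<longlonglongrightarrow> F z"
      using tendsto_scaleR[OF indicator_disk_radius_tendsto[of z] tendsto_const[of "F z"]] by simp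
  qed
  show "AE z in dA. norm (indicator (ball 0 (disk_radius i)) z *\<^sub>R F z) \<le> cmod (F z)" for i
    by (auto simp: indicator_def)
qed

text \<open>Pairing \<open>cnj z * f z\<close> with k is pairing f with \<open>z * k z\<close>.
  Since z^n has squared norm 1 / (n + 1), the factor (n + 1) / (n + 2) in
  \<open>backshift_coeff\<close> is the ratio of the squared norms of z^(n + 1) and z^n. On the disk
  of radius r the two sides differ by the factor r^2, which tends to 1.\<close>

lemma L2inner_cnj_mult:
  assumes f: "f \<in> bergman" and k: "k \<in> bergman"
  shows "L2inner (\<lambda>z. cnj z * f z) k = L2inner (backshift f) k"
proof -
  note f' = bergmanD[OF f] and k' = bergmanD[OF k]
  define a b where "a = taylor_coeff f" and "b = taylor_coeff k"
  have shift: "(\<lambda>n. (case n of 0 \<Rightarrow> 0 | Suc n \<Rightarrow> b n) * z ^ n) sums (z * k z)" if "z \<in> ball 0 1" for z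
  proof -
    have "(\<lambda>n. z * (b n * z ^ n)) sums (z * k z)"
      unfolding b_def by (intro sums_mult taylor_sums k' that)
    then show ?thesis
      using sums_Suc_iff[of "\<lambda>n. (case n of 0 \<Rightarrow> 0 | Suc n \<Rightarrow> b n) * z ^ n" "z * k z"]
      by (simp add: mult_ac)
  qed
  have "(\<integral>z. indicator (ball 0 r) z *\<^sub>R (cnj z * f z * cnj (k z)) \<partial>dA) =
      of_real (r\<^sup>2) * (\<integral>z. indicator (ball 0 r) z *\<^sub>R (backshift f z * cnj (k z)) \<partial>dA)"
    (is "?I = _ * ?J") if r: "0 \<le> r" "r < 1" for r
  proof -
    have "(\<lambda>n. a n * cnj (case n of 0 \<Rightarrow> 0 | Suc n \<Rightarrow> b n) * of_real (r ^ (2 * n + 2) / (n + 1))) sums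
        (\<integral>z. indicator (ball 0 r) z *\<^sub>R (f z * cnj (z * k z)) \<partial>dA)"
      unfolding a_def by (rule parseval_disk[OF taylor_sums[OF f'(1)] shift r])
    then have 1: "(\<lambda>n. a (Suc n) * cnj (b n) * of_real (r ^ (2 * Suc n + 2) / (Suc n + 1))) sums ?I"
      using sums_Suc_iff[of "\<lambda>n. a n * cnj (case n of 0 \<Rightarrow> 0 | Suc n \<Rightarrow> b n) * of_real (r ^ (2 * n + 2) / (n + 1))"
          "\<integral>z. indicator (ball 0 r) z *\<^sub>R (f z * cnj (z * k z)) \<partial>dA"]
      by (simp only: nat.case complex_cnj_zero mult_zero_left mult_zero_right add_0_right complex_cnj_mult mult_ac)
    have 2: "(\<lambda>n. of_real (r\<^sup>2) * (backshift_coeff f n * cnj (b n) * of_real (r ^ (2 * n + 2) / (n + 1)))) sums (of_real (r\<^sup>2) * ?J)"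
      unfolding b_def by (intro sums_mult parseval_disk[OF backshift_sums[OF f'(1)] taylor_sums[OF k'(1)] r])
    have "of_real (r\<^sup>2) * (backshift_coeff f n * cnj (b n) * of_real (r ^ (2 * n + 2) / (n + 1))) =
       a (Suc n) * cnj (b n) * of_real (r ^ (2 * Suc n + 2) / (Suc n + 1))" for n
    proof -
      have "complex_of_real (r\<^sup>2) * (of_nat (n + 1) / of_nat (n + 2)) * of_real (r ^ (2 * n + 2) / (n + 1)) =
          of_real (r\<^sup>2 * (real (n + 1) / real (n + 2)) * (r ^ (2 * n + 2) / (n + 1)))"
        by (simp only: of_real_mult of_real_divide of_real_of_nat_eq)
      also have "r\<^sup>2 * (real (n + 1) / real (n + 2)) * (r ^ (2 * n + 2) / (n + 1)) = r ^ (2 * Suc n + 2) / (Suc n + 1)"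
      proof -
        have "r ^ (2 * Suc n + 2) = r\<^sup>2 * r ^ (2 * n + 2)"
          by (simp flip: power_add)
        then show ?thesis by (simp del: power_Suc add: add.commute)
      qed
      finally show ?thesis
        unfolding backshift_coeff_def a_def by (simp only: mult_ac)
    qed
    with 1 2 show ?thesis by (simp only: sums_unique2)
  qed
  then have eq: "(\<integral>z. indicator (ball 0 (disk_radius i)) z *\<^sub>R (cnj z * f z * cnj (k z)) \<partial>dA) =
      of_real ((disk_radius i)\<^sup>2) * (\<integral>z. indicator (ball 0 (disk_radius i)) z *\<^sub>R (backshift f z * cnj (k z)) \<partial>dA)" for i
    using disk_radius(2,3) by blast
  have "(\<lambda>i. of_real ((disk_radius i)\<^sup>2) * (\<integral>z. indicator (ball 0 (disk_radius i)) z *\<^sub>R (backshift f z * cnj (k z)) \<partial>dA))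
      \<longlonglongrightarrow> of_real (1\<^sup>2) * L2inner (backshift f) k"
    unfolding L2inner_def
    by (intro tendsto_intros disk_radius(5) integral_disks_tendsto L2D_inner_integrable bergmanD(4) backshift_bergman f k)
  moreover have "(\<lambda>i. \<integral>z. indicator (ball 0 (disk_radius i)) z *\<^sub>R (cnj z * f z * cnj (k z)) \<partial>dA)
      \<longlonglongrightarrow> L2inner (\<lambda>z. cnj z * f z) k"
    unfolding L2inner_def
    by (intro integral_disks_tendsto L2D_inner_integrable L2D_cnj_mult f' k')
  ultimately show ?thesis
    unfolding eq by (simp add: LIMSEQ_unique)
qed

lemma disk_algebra_bounded:
  fixes p :: "complex \<Rightarrow> complex"
  assumes "continuous_on (cball 0 1) p"
  obtains B where "\<And>z. z \<in> cball 0 1 \<Longrightarrow> cmod (p z) \<le> B"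
proof -
  have "compact (p ` cball 0 1)"
    by (intro compact_continuous_image assms) auto
  then show ?thesis
    using that compact_imp_bounded bounded_iff by (metis imageI)
qed

lemma bergman_mult:
  assumes p: "p holomorphic_on ball 0 1" "continuous_on (cball 0 1) p" and f: "f \<in> bergman"
  shows "(\<lambda>z. p z * f z) \<in> bergman"
proof -
  obtain B where "\<And>z. z \<in> cball 0 1 \<Longrightarrow> cmod (p z) \<le> B"
    using disk_algebra_bounded[OF p(2)] by blast
  then have "(\<lambda>z. p z * f z) \<in> L2D"
    by (intro L2D_bounded_mult[where B = B] bergmanD(4)[OF f] holomorphic_measurable_dA p) auto
  then show ?thesis
    using p bergmanD[OF f] by (auto simp: bergman_def intro!: holomorphic_intros)
qed

lemma bergman_add:
  assumes f: "f \<in> bergman" and g: "g \<in> bergman"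
  shows "(\<lambda>z. f z + g z) \<in> bergman"
proof -
  have "(\<lambda>z. (-1) * g z) \<in> bergman"
    by (rule bergman_mult[OF _ _ g]) (auto intro!: holomorphic_intros continuous_intros)
  from bergman_diff[OF f this] show ?thesis by simp
qed

lemma L2inner_add_left:
  assumes "f \<in> L2D" "g \<in> L2D" "k \<in> L2D"
  shows "L2inner (\<lambda>z. f z + g z) k = L2inner f k + L2inner g k"
  unfolding L2inner_def distrib_right
  by (intro Bochner_Integration.integral_add L2D_inner_integrable assms)

lemma toeplitz_symbol_bounded:
  assumes "continuous_on (cball 0 1) p"
  obtains B where "\<And>z. z \<in> ball 0 1 \<Longrightarrow> cmod (cnj z + p z) \<le> B"
proof -
  have "continuous_on (cball 0 1) (\<lambda>z. cnj z + p z)" by (intro continuous_intros assms)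
  from disk_algebra_bounded[OF this] that show ?thesis by (metis ball_subset_cball subsetD)
qed

text \<open>The explicit form serves the differential equation; the form with inner products serves
  the Fredholm argument, where the projection disappears against a Bergman function.\<close>

lemma
  assumes p: "p holomorphic_on ball 0 1" "continuous_on (cball 0 1) p" and f: "f \<in> bergman"
  shows toeplitz_eq: "toeplitz (\<lambda>z. cnj z + p z) f = (\<lambda>z. backshift f z + p z * f z)"
    and toeplitz_bergman: "toeplitz (\<lambda>z. cnj z + p z) f \<in> bergman"
    and toeplitz_inner: "k \<in> bergman \<Longrightarrow>
      L2inner (toeplitz (\<lambda>z. cnj z + p z) f) k = L2inner (\<lambda>z. (cnj z + p z) * f z) k"
proof -
  have pf: "(\<lambda>z. p z * f z) \<in> bergman" by (rule bergman_mult[OF p f])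
  have h: "(\<lambda>z. backshift f z + p z * f z) \<in> bergman"
    by (intro bergman_add backshift_bergman f pf)
  obtain B where B: "\<And>z. z \<in> ball 0 1 \<Longrightarrow> cmod (cnj z + p z) \<le> B"
    using toeplitz_symbol_bounded[OF p(2)] by blast
  have "p \<in> borel_measurable dA" by (rule holomorphic_measurable_dA[OF p(1)])
  then have L2: "(\<lambda>z. (cnj z + p z) * f z) \<in> L2D"
    by (intro L2D_bounded_mult[OF bergmanD(4)[OF f] _ B]) auto
  have orth: "L2inner (\<lambda>z. (cnj z + p z) * f z) k = L2inner (\<lambda>z. backshift f z + p z * f z) k"
    if "k \<in> bergman" for k
  proof -
    have "L2inner (\<lambda>z. cnj z * f z + p z * f z) k = L2inner (\<lambda>z. backshift f z + p z * f z) k"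
      using that f pf backshift_bergman[OF f]
      by (simp add: L2inner_add_left L2D_cnj_mult bergmanD L2inner_cnj_mult)
    then show ?thesis by (simp only: distrib_right)
  qed
  show eq: "toeplitz (\<lambda>z. cnj z + p z) f = (\<lambda>z. backshift f z + p z * f z)"
    unfolding toeplitz_def by (rule bergman_proj_eqI[OF L2 h orth])
  show "toeplitz (\<lambda>z. cnj z + p z) f \<in> bergman"
    "k \<in> bergman \<Longrightarrow>
      L2inner (toeplitz (\<lambda>z. cnj z + p z) f) k = L2inner (\<lambda>z. (cnj z + p z) * f z) k"
    unfolding eq using h orth by auto
qed

section \<open>Peaking functions at a boundary point\<close>

definition peak :: "complex \<Rightarrow> complex \<Rightarrow> complex" where
  "peak \<zeta> z = (1 + cnj \<zeta> * z) / 2"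

text \<open>The parallelogram law for 1 and w = \<open>cnj \<zeta> * z\<close>: as the modulus of w
  is at most 1, what 1 + w gains is lost by w - 1.\<close>

lemma peak_upper:
  assumes "cmod \<zeta> = 1" "cmod z \<le> 1"
  shows "(cmod (peak \<zeta> z))\<^sup>2 \<le> 1 - (cmod (z - \<zeta>))\<^sup>2 / 4"
proof -
  define w where "w = cnj \<zeta> * z"
  have "z - \<zeta> = \<zeta> * (w - 1)"
    using assms(1) complex_norm_square[of \<zeta>] by (simp add: w_def algebra_simps)
  then have 1: "cmod (z - \<zeta>) = cmod (w - 1)" using assms(1) by (simp add: norm_mult)
  have "cmod w \<le> 1" using assms by (simp add: w_def norm_mult)
  then have w: "(cmod w)\<^sup>2 \<le> 1" by (simp add: power_le_one)
  have "(cmod (1 + w))\<^sup>2 + (cmod (w - 1))\<^sup>2 = 2 + 2 * (cmod w)\<^sup>2"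
    unfolding cmod_power2 by (simp add: power2_eq_square algebra_simps)
  then have "(cmod (1 + w))\<^sup>2 + (cmod (w - 1))\<^sup>2 \<le> 4" using w by simp
  moreover have "(cmod (peak \<zeta> z))\<^sup>2 = (cmod (1 + w))\<^sup>2 / 4"
    by (simp add: peak_def w_def norm_divide power_divide)
  ultimately show ?thesis using 1 by simp
qed

lemma peak_lower:
  assumes "cmod \<zeta> = 1"
  shows "1 - cmod (z - \<zeta>) / 2 \<le> cmod (peak \<zeta> z)"
proof -
  have "peak \<zeta> z = 1 - cnj \<zeta> * (\<zeta> - z) / 2"
    using assms complex_norm_square[of \<zeta>] by (simp add: peak_def field_simps)
  then have "cmod (peak \<zeta> z) \<ge> cmod 1 - cmod (cnj \<zeta> * (\<zeta> - z) / 2)"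
    by (metis norm_triangle_ineq2)
  then show ?thesis using assms by (simp add: norm_mult norm_divide norm_minus_commute)
qed

definition peak_mass :: "complex \<Rightarrow> nat \<Rightarrow> real" where
  "peak_mass \<zeta> N = (\<integral>z. (cmod (peak \<zeta> z ^ N))\<^sup>2 \<partial>dA)"

definition peak_fun :: "complex \<Rightarrow> nat \<Rightarrow> complex \<Rightarrow> complex" where
  "peak_fun \<zeta> N z = (if z \<in> ball 0 1 then peak \<zeta> z ^ N / of_real (sqrt (peak_mass \<zeta> N)) else 0)"

lemma peak_le_1:
  assumes "cmod \<zeta> = 1" "cmod z \<le> 1"
  shows "cmod (peak \<zeta> z) \<le> 1"
proof -
  have "(cmod (peak \<zeta> z))\<^sup>2 \<le> 1 - (cmod (z - \<zeta>))\<^sup>2 / 4"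
    by (rule peak_upper[OF assms])
  also have "\<dots> \<le> 1\<^sup>2" by simp
  finally show ?thesis by (rule power2_le_imp_le) simp
qed

lemma peak_holomorphic: "(\<lambda>z. peak \<zeta> z ^ N) holomorphic_on A"
  unfolding peak_def by (intro holomorphic_intros) auto

lemma peak_power_integrable:
  assumes "cmod \<zeta> = 1"
  shows "integrable dA (\<lambda>z. (cmod (peak \<zeta> z ^ N))\<^sup>2)"
proof (rule dA.integrable_const_bound[where B = 1])
  note [measurable] = holomorphic_measurable_dA[OF peak_holomorphic]
  show "(\<lambda>z. (cmod (peak \<zeta> z ^ N))\<^sup>2) \<in> borel_measurable dA" by measurable
  show "AE z in dA. norm ((cmod (peak \<zeta> z ^ N))\<^sup>2) \<le> 1"
    using peak_le_1[OF assms] by (intro AE_I2) (auto simp: norm_power intro!: power_le_one)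
qed

text \<open>Within distance \<delta> of \<zeta> the squared modulus of the peak is at least (1 -
  \<delta>/2)^2 \<ge> 1 - \<delta>, and that part of the disk has positive area m. So the mass
  decays more slowly than any prescribed geometric rate, which is what lets normalised peaks become
  small away from \<zeta>.\<close>

lemma peak_mass_lower:
  assumes \<zeta>: "cmod \<zeta> = 1" and \<delta>: "0 < \<delta>" "\<delta> < 1"
  obtains m where "m > 0" "\<And>N. m * (1 - \<delta>) ^ N \<le> peak_mass \<zeta> N"
proof
  define U where "U = ball 0 1 \<inter> ball \<zeta> \<delta>"
  have U: "U \<in> sets dA" "U \<subseteq> space dA"
    by (auto simp: U_def sets_dA sets_restrict_space)
  have "(1 - \<delta> / 2) *\<^sub>R \<zeta> \<in> U"
  proof -
    have "\<zeta> - (1 - \<delta> / 2) *\<^sub>R \<zeta> = (\<delta> / 2) *\<^sub>R \<zeta>" by (simp add: algebra_simps)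
    then show ?thesis using \<zeta> \<delta> by (simp add: U_def dist_norm)
  qed
  then have "U \<noteq> {}" by blast
  then have "0 < emeasure dA U"
    by (intro emeasure_dA_open_pos) (auto simp: U_def)
  then show m: "0 < measure dA U"
    by (simp add: dA.emeasure_eq_measure)
  fix N
  have "measure dA U * (1 - \<delta>) ^ N = (\<integral>z. indicator U z * (1 - \<delta>) ^ N \<partial>dA)"
    using U by (simp add: Int_absorb2)
  also have "\<dots> \<le> peak_mass \<zeta> N"
    unfolding peak_mass_def
  proof (intro integral_mono peak_power_integrable[OF \<zeta>])
    show "integrable dA (\<lambda>z. indicator U z * (1 - \<delta>) ^ N)"
      using U by (intro integrable_mult_left) (simp add: dA.emeasure_finite less_top[symmetric])
    fix z
    show "indicator U z * (1 - \<delta>) ^ N \<le> (cmod (peak \<zeta> z ^ N))\<^sup>2"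
    proof (cases "z \<in> U")
      case True
      then have "cmod (z - \<zeta>) < \<delta>" by (auto simp: U_def dist_norm norm_minus_commute)
      then have *: "1 - \<delta> / 2 \<le> cmod (peak \<zeta> z)" using peak_lower[OF \<zeta>, of z] by linarith
      have "1 - \<delta> \<le> (1 - \<delta> / 2)\<^sup>2" by (simp add: power2_eq_square algebra_simps)
      also have "\<dots> \<le> (cmod (peak \<zeta> z))\<^sup>2" using * \<delta> by (intro power_mono) auto
      finally have "(1 - \<delta>) ^ N \<le> ((cmod (peak \<zeta> z))\<^sup>2) ^ N"
        using \<delta> by (intro power_mono) auto
      also have "\<dots> = (cmod (peak \<zeta> z ^ N))\<^sup>2"
        by (simp add: norm_power flip: power_mult) (simp add: mult.commute)
      finally show ?thesis using True by simp
    qed simp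
  qed
  finally show "measure dA U * (1 - \<delta>) ^ N \<le> peak_mass \<zeta> N" .
qed

lemma peak_mass_pos:
  assumes "cmod \<zeta> = 1"
  shows "0 < peak_mass \<zeta> N"
proof -
  obtain m where "m > 0" "\<And>N. m * (1 - 1 / 2) ^ N \<le> peak_mass \<zeta> N"
    using peak_mass_lower[OF assms, of "1 / 2"] by auto
  then have "0 < m * (1 - 1 / 2) ^ N" "m * (1 - 1 / 2) ^ N \<le> peak_mass \<zeta> N"
    by auto
  then show ?thesis by linarith
qed

lemma peak_fun_square:
  assumes "cmod \<zeta> = 1" "z \<in> ball 0 1"
  shows "(cmod (peak_fun \<zeta> N z))\<^sup>2 = (cmod (peak \<zeta> z ^ N))\<^sup>2 / peak_mass \<zeta> N"
  using assms peak_mass_pos[OF assms(1), of N]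
  by (simp add: peak_fun_def norm_divide power_divide)

lemma
  assumes "cmod \<zeta> = 1"
  shows peak_fun_bergman: "peak_fun \<zeta> N \<in> bergman"
    and peak_fun_norm: "(\<integral>z. (cmod (peak_fun \<zeta> N z))\<^sup>2 \<partial>dA) = 1"
proof -
  have eq: "integrable dA (\<lambda>z. (cmod (peak_fun \<zeta> N z))\<^sup>2) =
      integrable dA (\<lambda>z. (cmod (peak \<zeta> z ^ N))\<^sup>2 / peak_mass \<zeta> N)"
    using peak_fun_square[OF assms] by (intro Bochner_Integration.integrable_cong refl) simp
  show "peak_fun \<zeta> N \<in> bergman"
  proof (rule bergmanI)
    have "(\<lambda>z. peak \<zeta> z ^ N / of_real (sqrt (peak_mass \<zeta> N))) holomorphic_on ball 0 1"
      using peak_mass_pos[OF assms, of N] by (intro holomorphic_intros peak_holomorphic) auto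
    then show "peak_fun \<zeta> N holomorphic_on ball 0 1"
      by (rule holomorphic_transform) (simp add: peak_fun_def)
    show "integrable dA (\<lambda>z. (cmod (peak_fun \<zeta> N z))\<^sup>2)"
      unfolding eq by (intro integrable_divide_zero peak_power_integrable[OF assms])
  qed (auto simp: peak_fun_def)
  have "(\<integral>z. (cmod (peak_fun \<zeta> N z))\<^sup>2 \<partial>dA) = (\<integral>z. (cmod (peak \<zeta> z ^ N))\<^sup>2 / peak_mass \<zeta> N \<partial>dA)"
    using peak_fun_square[OF assms] by (intro Bochner_Integration.integral_cong refl) simp
  also have "\<dots> = peak_mass \<zeta> N / peak_mass \<zeta> N"
    unfolding peak_mass_def by simp
  finally show "(\<integral>z. (cmod (peak_fun \<zeta> N z))\<^sup>2 \<partial>dA) = 1"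
    using peak_mass_pos[OF assms, of N] by simp
qed

text \<open>At distance d or more from \<zeta> the numerator is at most (1 - d^2/4)^N. Half of that
  loss, d^2/8, is used as \<delta> in the lower bound of the mass, so the quotient decays
  geometrically with ratio \<theta> < 1.\<close>

lemma peak_fun_concentrates:
  assumes \<zeta>: "cmod \<zeta> = 1" and "0 < \<delta>" "0 < \<epsilon>"
  shows "eventually (\<lambda>N. \<forall>z\<in>ball 0 1. \<delta> \<le> cmod (z - \<zeta>) \<longrightarrow> (cmod (peak_fun \<zeta> N z))\<^sup>2 \<le> \<epsilon>) sequentially"
proof -
  \<comment> \<open>The cap at 1 makes d^2/8 an admissible parameter for
    \<open>peak_mass_lower\<close> and keeps 1 - d^2/4 nonnegative; \<delta> itself may be
    large.\<close>
  define d where "d = min \<delta> 1"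
  have d: "0 < d" "d \<le> 1" "d \<le> \<delta>" using assms by (auto simp: d_def)
  have d2: "0 < d\<^sup>2" "d\<^sup>2 \<le> 1" using d by (auto simp: power_le_one)
  obtain m where m: "m > 0" "\<And>N. m * (1 - d\<^sup>2 / 8) ^ N \<le> peak_mass \<zeta> N"
    using peak_mass_lower[OF \<zeta>, of "d\<^sup>2 / 8"] d2 by auto
  define \<theta> where "\<theta> = (1 - d\<^sup>2 / 4) / (1 - d\<^sup>2 / 8)"
  have \<theta>: "0 \<le> \<theta>" "\<theta> < 1" using d2 by (auto simp: \<theta>_def divide_simps)
  have "(\<lambda>N. \<theta> ^ N / m) \<longlonglongrightarrow> 0 / m"
    using \<theta> m by (intro tendsto_divide LIMSEQ_power_zero tendsto_const) auto
  then have "eventually (\<lambda>N. \<theta> ^ N / m < \<epsilon>) sequentially"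
    using assms(3) by (intro order_tendstoD(2)) auto
  then show ?thesis
  proof eventually_elim
    case (elim N)
    show ?case
    proof (intro ballI impI)
      fix z :: complex assume z: "z \<in> ball 0 1" "\<delta> \<le> cmod (z - \<zeta>)"
      have "d\<^sup>2 \<le> (cmod (z - \<zeta>))\<^sup>2" using d z by (intro power_mono) auto
      then have "(cmod (peak \<zeta> z))\<^sup>2 \<le> 1 - d\<^sup>2 / 4"
        using peak_upper[OF \<zeta>, of z] z by auto
      then have "((cmod (peak \<zeta> z))\<^sup>2) ^ N \<le> (1 - d\<^sup>2 / 4) ^ N" by (intro power_mono) auto
      moreover have "(cmod (peak \<zeta> z ^ N))\<^sup>2 = ((cmod (peak \<zeta> z))\<^sup>2) ^ N"
        by (simp add: norm_power flip: power_mult) (simp add: mult.commute)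
      ultimately have "(cmod (peak_fun \<zeta> N z))\<^sup>2 \<le> (1 - d\<^sup>2 / 4) ^ N / peak_mass \<zeta> N"
        using peak_fun_square[OF \<zeta> z(1), of N] peak_mass_pos[OF \<zeta>, of N] by (simp add: divide_right_mono)
      also have "\<dots> \<le> (1 - d\<^sup>2 / 4) ^ N / (m * (1 - d\<^sup>2 / 8) ^ N)"
        using m d2 peak_mass_pos[OF \<zeta>, of N] by (intro divide_left_mono mult_pos_pos) auto
      also have "\<dots> = \<theta> ^ N / m" by (simp add: \<theta>_def power_divide)
      finally show "(cmod (peak_fun \<zeta> N z))\<^sup>2 \<le> \<epsilon>" using elim by linarith
    qed
  qed
qed

text \<open>Near \<zeta> the factor \<psi> is small while the peak has norm 1; elsewhere \<psi> is
  bounded while the peak is uniformly small.\<close>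

lemma peak_fun_mult_tendsto_0:
  assumes \<zeta>: "cmod \<zeta> = 1" and \<psi>: "continuous_on (cball 0 1) \<psi>" "\<psi> \<zeta> = 0"
  shows "(\<lambda>N. \<integral>z. (cmod (\<psi> z * peak_fun \<zeta> N z))\<^sup>2 \<partial>dA) \<longlonglongrightarrow> 0"
proof (rule tendstoI)
  fix e :: real assume "e > 0"
  obtain B where B: "\<And>z. z \<in> cball 0 1 \<Longrightarrow> cmod (\<psi> z) \<le> B"
    using disk_algebra_bounded[OF \<psi>(1)] by blast
  have "\<zeta> \<in> cball 0 1" using \<zeta> by simp
  then obtain \<delta> where \<delta>: "\<delta> > 0" "\<And>z. z \<in> cball 0 1 \<Longrightarrow> dist z \<zeta> < \<delta> \<Longrightarrow> cmod (\<psi> z) < sqrt (e / 3)"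
    using \<psi> \<open>e > 0\<close> unfolding continuous_on_iff
    by (metis dist_0_norm dist_commute real_sqrt_gt_zero zero_less_divide_iff zero_less_numeral)
  have near: "(cmod (\<psi> z))\<^sup>2 \<le> e / 3" if "z \<in> ball 0 1" "cmod (z - \<zeta>) < \<delta>" for z
  proof -
    have "(cmod (\<psi> z))\<^sup>2 \<le> (sqrt (e / 3))\<^sup>2"
      using \<delta>(2)[of z] that by (intro power_mono) (auto simp: dist_norm)
    then show ?thesis using \<open>e > 0\<close> by simp
  qed
  \<comment> \<open>Makes the contribution away from \<zeta> at most e/3, with another e/3 from the
    neighbourhood of \<zeta>; the summand 1 guards against B = 0.\<close>
  define \<epsilon> where "\<epsilon> = e / (3 * (B\<^sup>2 + 1))"
  have "B\<^sup>2 + 1 > 0" by (simp add: add_nonneg_pos)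
  then have \<epsilon>: "\<epsilon> > 0" "B\<^sup>2 * \<epsilon> \<le> e / 3" using \<open>e > 0\<close>
    by (auto simp: \<epsilon>_def divide_simps algebra_simps)
  from peak_fun_concentrates[OF \<zeta> \<delta>(1) \<epsilon>(1)]
  show "eventually (\<lambda>N. dist (\<integral>z. (cmod (\<psi> z * peak_fun \<zeta> N z))\<^sup>2 \<partial>dA) 0 < e) sequentially"
  proof eventually_elim
    case (elim N)
    have le: "(cmod (\<psi> z * peak_fun \<zeta> N z))\<^sup>2 \<le> e / 3 * (cmod (peak_fun \<zeta> N z))\<^sup>2 + e / 3"
      if z: "z \<in> ball 0 1" for z
    proof (cases "cmod (z - \<zeta>) < \<delta>")
      case True
      have "(cmod (\<psi> z))\<^sup>2 * (cmod (peak_fun \<zeta> N z))\<^sup>2 \<le> e / 3 * (cmod (peak_fun \<zeta> N z))\<^sup>2"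
        by (intro mult_right_mono near z True) auto
      then show ?thesis using \<open>e > 0\<close> by (simp add: norm_mult power_mult_distrib)
    next
      case False
      have "(cmod (\<psi> z))\<^sup>2 * (cmod (peak_fun \<zeta> N z))\<^sup>2 \<le> B\<^sup>2 * \<epsilon>"
        using False elim z by (intro mult_mono power_mono B) auto
      also have "\<dots> \<le> e / 3" by (rule \<epsilon>)
      finally have "(cmod (\<psi> z))\<^sup>2 * (cmod (peak_fun \<zeta> N z))\<^sup>2 \<le> e / 3" .
      moreover have "0 \<le> e / 3 * (cmod (peak_fun \<zeta> N z))\<^sup>2" using \<open>e > 0\<close> by simp
      ultimately show ?thesis by (simp add: norm_mult power_mult_distrib)
    qed
    have int: "integrable dA (\<lambda>z. (cmod (peak_fun \<zeta> N z))\<^sup>2)"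
      by (rule bergmanD(2)[OF peak_fun_bergman[OF \<zeta>]])
    have "(\<integral>z. (cmod (\<psi> z * peak_fun \<zeta> N z))\<^sup>2 \<partial>dA) \<le>
        (\<integral>z. e / 3 * (cmod (peak_fun \<zeta> N z))\<^sup>2 + e / 3 \<partial>dA)"
    proof (rule integral_mono')
      show "integrable dA (\<lambda>z. e / 3 * (cmod (peak_fun \<zeta> N z))\<^sup>2 + e / 3)"
        using int by (intro Bochner_Integration.integrable_add integrable_mult_right) auto
    qed (use le \<open>e > 0\<close> in auto)
    also have "\<dots> = e / 3 * 1 + e / 3"
      using int by (subst Bochner_Integration.integral_add) (auto simp: peak_fun_norm[OF \<zeta>] measure_dA_ball_1)
    also have "\<dots> < e" using \<open>e > 0\<close> by simp
    finally show ?case by (simp add: integral_nonneg_AE)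
  qed
qed

text \<open>Since \<zeta> lies on the circle, every point of the open disk eventually leaves the
  shrinking balls, and the squared modulus of b dominates.\<close>

lemma integral_near_boundary_point_tendsto_0:
  fixes b :: "complex \<Rightarrow> complex"
  assumes \<zeta>: "cmod \<zeta> = 1" and b: "b \<in> L2D"
  shows "(\<lambda>m. \<integral>z. indicator (ball \<zeta> (1 / Suc m)) z * (cmod (b z))\<^sup>2 \<partial>dA) \<longlonglongrightarrow> 0"
proof -
  have [measurable]: "b \<in> borel_measurable dA" using b by (auto simp: L2D_def)
  have [measurable]: "(\<lambda>z. indicator (ball \<zeta> r) z :: real) \<in> borel_measurable dA" for r
    by (intro measurable_dA_I borel_measurable_indicator) auto
  have "(\<lambda>m. \<integral>z. indicator (ball \<zeta> (1 / Suc m)) z * (cmod (b z))\<^sup>2 \<partial>dA) \<longlonglongrightarrow> (\<integral>z. 0 \<partial>dA)"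
  proof (rule integral_dominated_convergence[where w = "\<lambda>z. (cmod (b z))\<^sup>2"])
    show "integrable dA (\<lambda>z. (cmod (b z))\<^sup>2)" using b by (auto simp: L2D_def)
    show "AE z in dA. (\<lambda>m. indicator (ball \<zeta> (1 / Suc m)) z * (cmod (b z))\<^sup>2) \<longlonglongrightarrow> 0"
    proof (rule AE_I2)
      fix z assume "z \<in> space dA"
      then have "dist \<zeta> z > 0" using \<zeta> by auto
      then have "eventually (\<lambda>m. 1 / Suc m < dist \<zeta> z) sequentially"
        using order_tendstoD(2)[OF LIMSEQ_inverse_real_of_nat, of "dist \<zeta> z"]
        by (simp add: inverse_eq_divide)
      then have "eventually (\<lambda>m. indicator (ball \<zeta> (1 / Suc m)) z * (cmod (b z))\<^sup>2 = 0) sequentially"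
        by eventually_elim (auto simp: indicator_def)
      then show "(\<lambda>m. indicator (ball \<zeta> (1 / Suc m)) z * (cmod (b z))\<^sup>2) \<longlonglongrightarrow> 0"
        by (rule tendsto_eventually)
    qed
    show "AE z in dA. norm (indicator (ball \<zeta> (1 / Suc m)) z * (cmod (b z))\<^sup>2) \<le> (cmod (b z))\<^sup>2" for m
      by (rule AE_I2) (auto simp: indicator_def)
  qed measurable
  then show ?thesis by simp
qed

text \<open>Close to \<zeta> the function b carries little mass, by absolute continuity, and
  elsewhere the peak is uniformly small; in both places the other factor has bounded norm.\<close>

lemma peak_fun_weakly_null:
  assumes \<zeta>: "cmod \<zeta> = 1" and b: "b \<in> L2D"
  shows "(\<lambda>N. L2inner b (peak_fun \<zeta> N)) \<longlonglongrightarrow> 0"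
proof (rule tendstoI)
  fix e :: real assume "e > 0"
  define K where "K = (\<integral>z. (cmod (b z))\<^sup>2 \<partial>dA)"
  have K: "K \<ge> 0" by (simp add: K_def)
  \<comment> \<open>Chosen so that t / 2 * (1 + K) = e/4. The mass of b near \<zeta> and the
    smallness of the peak elsewhere are then both taken as t * e / 2, so each contributes at most
    e/4.\<close>
  define t where "t = e / 2 / (1 + K)"
  have t: "t > 0" using \<open>e > 0\<close> K by (simp add: t_def)
  have tK: "t / 2 * (1 + K) = e / 4"
  proof -
    have "1 + K \<noteq> 0" using K by simp
    then have "t * (1 + K) = e / 2" using t_def nonzero_eq_divide_eq by blast
    then show ?thesis by simp
  qed
  have "eventually (\<lambda>m. (\<integral>z. indicator (ball \<zeta> (1 / Suc m)) z * (cmod (b z))\<^sup>2 \<partial>dA) < t * e / 2) sequentially"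
    using integral_near_boundary_point_tendsto_0[OF \<zeta> b] t \<open>e > 0\<close> by (intro order_tendstoD(2)) auto
  then obtain m where m: "(\<integral>z. indicator (ball \<zeta> (1 / Suc m)) z * (cmod (b z))\<^sup>2 \<partial>dA) < t * e / 2"
    by (auto simp: eventually_sequentially)
  define \<delta> where "\<delta> = 1 / real (Suc m)"
  have \<delta>: "\<delta> > 0" by (simp add: \<delta>_def)
  have "t * e / 2 > 0" using t \<open>e > 0\<close> by simp
  from peak_fun_concentrates[OF \<zeta> \<delta> this]
  show "eventually (\<lambda>N. dist (L2inner b (peak_fun \<zeta> N)) 0 < e) sequentially"
  proof eventually_elim
    case (elim N)
    let ?h = "peak_fun \<zeta> N"
    \<comment> \<open>A single integrable majorant for both cases: \<open>amgm\<close> puts the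
      large weight 1 / (2 * t) on b near \<zeta>, where its mass is small, and on the peak
      elsewhere, where its size is small.\<close>
    let ?w = "\<lambda>z. 1 / (2 * t) * (indicator (ball \<zeta> \<delta>) z * (cmod (b z))\<^sup>2) +
        t / 2 * ((cmod (?h z))\<^sup>2 + (cmod (b z))\<^sup>2) + e / 4"
    have amgm: "x * y \<le> 1 / (2 * t) * x\<^sup>2 + t / 2 * y\<^sup>2" for x y :: real
    proof -
      have "0 \<le> (x - t * y)\<^sup>2" by simp
      then have "2 * t * (x * y) \<le> x\<^sup>2 + t\<^sup>2 * y\<^sup>2" by (simp add: power2_eq_square algebra_simps)
      then show ?thesis using t by (simp add: field_simps power2_eq_square)
    qed
    have le: "cmod (b z * cnj (?h z)) \<le> ?w z" if z: "z \<in> ball 0 1" for z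
    proof (cases "z \<in> ball \<zeta> \<delta>")
      case True
      have "cmod (b z) * cmod (?h z) \<le> 1 / (2 * t) * (cmod (b z))\<^sup>2 + t / 2 * (cmod (?h z))\<^sup>2"
        by (rule amgm)
      also have "\<dots> \<le> ?w z" using True t \<open>e > 0\<close> by (simp add: algebra_simps)
      finally show ?thesis by (simp add: norm_mult)
    next
      case False
      then have "(cmod (?h z))\<^sup>2 \<le> t * e / 2" using elim z by (auto simp: dist_norm norm_minus_commute)
      then have "1 / (2 * t) * (cmod (?h z))\<^sup>2 \<le> 1 / (2 * t) * (t * e / 2)" using t by (intro mult_left_mono) auto
      also have "\<dots> = e / 4" using t by simp
      finally have 1: "1 / (2 * t) * (cmod (?h z))\<^sup>2 \<le> e / 4" .
      have "cmod (?h z) * cmod (b z) \<le> 1 / (2 * t) * (cmod (?h z))\<^sup>2 + t / 2 * (cmod (b z))\<^sup>2"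
        by (rule amgm)
      also have "\<dots> \<le> e / 4 + t / 2 * (cmod (b z))\<^sup>2" using 1 by simp
      also have "\<dots> \<le> ?w z" using False t \<open>e > 0\<close> by (simp add: algebra_simps)
      finally show ?thesis by (simp add: norm_mult mult.commute)
    qed
    have [measurable]: "(\<lambda>z. indicator (ball \<zeta> \<delta>) z :: real) \<in> borel_measurable dA"
      by (intro measurable_dA_I borel_measurable_indicator) auto
    have [measurable]: "b \<in> borel_measurable dA" using b by (auto simp: L2D_def)
    have ib: "integrable dA (\<lambda>z. (cmod (b z))\<^sup>2)" using b by (auto simp: L2D_def)
    have ih: "integrable dA (\<lambda>z. (cmod (?h z))\<^sup>2)"
      by (rule bergmanD(2)[OF peak_fun_bergman[OF \<zeta>]])
    have i1: "integrable dA (\<lambda>z. indicator (ball \<zeta> \<delta>) z * (cmod (b z))\<^sup>2)"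
      by (rule Bochner_Integration.integrable_bound[OF ib]) (auto simp: indicator_def)
    have "cmod (L2inner b ?h) \<le> (\<integral>z. cmod (b z * cnj (?h z)) \<partial>dA)"
      unfolding L2inner_def by (rule integral_norm_bound)
    also have "\<dots> \<le> (\<integral>z. ?w z \<partial>dA)"
    proof (rule integral_mono')
      show "integrable dA ?w" using ib ih i1 by auto
      show "cmod (b z * cnj (?h z)) \<le> ?w z" if "z \<in> space dA" for z using le that by simp
      show "0 \<le> ?w z" for z using t \<open>e > 0\<close> by simp
    qed
    also have "\<dots> = 1 / (2 * t) * (\<integral>z. indicator (ball \<zeta> \<delta>) z * (cmod (b z))\<^sup>2 \<partial>dA) + t / 2 * (1 + K) + e / 4"
      using ib ih i1 by (simp add: peak_fun_norm[OF \<zeta>] K_def measure_dA_ball_1)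
    also have "\<dots> < 1 / (2 * t) * (t * e / 2) + e / 4 + e / 4"
      unfolding tK \<delta>_def by (intro add_strict_right_mono mult_strict_left_mono m) (use t in auto)
    also have "\<dots> \<le> e" using t \<open>e > 0\<close> by simp
    finally show ?case by simp
  qed
qed

text \<open>A compact subdisk stays away from \<zeta>. The uniform bound there makes series of peaks
  converge locally uniformly, hence to a holomorphic function.\<close>

lemma peak_fun_locally_bounded:
  assumes \<zeta>: "cmod \<zeta> = 1" and \<rho>: "\<rho> < 1"
  shows "eventually (\<lambda>N. \<forall>z\<in>cball 0 \<rho>. cmod (peak_fun \<zeta> N z) \<le> 1) sequentially"
proof -
  have "eventually (\<lambda>N. \<forall>z\<in>ball 0 1. 1 - \<rho> \<le> cmod (z - \<zeta>) \<longrightarrow> (cmod (peak_fun \<zeta> N z))\<^sup>2 \<le> 1) sequentially"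
    by (rule peak_fun_concentrates[OF \<zeta>]) (use \<rho> in auto)
  then show ?thesis
  proof eventually_elim
    case (elim N)
    show ?case
    proof
      fix z :: complex assume z: "z \<in> cball 0 \<rho>"
      have "cmod \<zeta> - cmod z \<le> cmod (z - \<zeta>)" by (metis norm_minus_commute norm_triangle_ineq2)
      then have "(cmod (peak_fun \<zeta> N z))\<^sup>2 \<le> 1" using elim z \<zeta> \<rho> by auto
      then have "(cmod (peak_fun \<zeta> N z))\<^sup>2 \<le> 1\<^sup>2" by simp
      then show "cmod (peak_fun \<zeta> N z) \<le> 1" by (rule power2_le_imp_le) simp
    qed
  qed
qed

section \<open>Fredholmness and the boundary values of the symbol\<close>

text \<open>Cauchy-Schwarz in additive form. The parameter t is set to \<epsilon> when the second
  integral is of order \<epsilon>^2, and to 1 for unit vectors.\<close>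

lemma integral_mult_le_squares:
  assumes f: "f \<in> L2D" and g: "g \<in> L2D" and t: "t > 0"
  shows "(\<integral>z. cmod (f z * cnj (g z)) \<partial>dA) \<le>
    t / 2 * (\<integral>z. (cmod (f z))\<^sup>2 \<partial>dA) + 1 / (2 * t) * (\<integral>z. (cmod (g z))\<^sup>2 \<partial>dA)"
proof -
  have int: "integrable dA (\<lambda>z. (cmod (f z))\<^sup>2)" "integrable dA (\<lambda>z. (cmod (g z))\<^sup>2)"
    using f g by (auto simp: L2D_def)
  have "(\<integral>z. cmod (f z * cnj (g z)) \<partial>dA) \<le> (\<integral>z. t / 2 * (cmod (f z))\<^sup>2 + 1 / (2 * t) * (cmod (g z))\<^sup>2 \<partial>dA)"
  proof (rule integral_mono)
    show "integrable dA (\<lambda>z. cmod (f z * cnj (g z)))"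
      by (intro integrable_norm L2D_inner_integrable f g)
    show "integrable dA (\<lambda>z. t / 2 * (cmod (f z))\<^sup>2 + 1 / (2 * t) * (cmod (g z))\<^sup>2)"
      using int by auto
    fix z
    have "0 \<le> (t * cmod (f z) - cmod (g z))\<^sup>2" by simp
    then have "2 * t * (cmod (f z) * cmod (g z)) \<le> t\<^sup>2 * (cmod (f z))\<^sup>2 + (cmod (g z))\<^sup>2"
      by (simp add: power2_eq_square algebra_simps)
    then show "cmod (f z * cnj (g z)) \<le> t / 2 * (cmod (f z))\<^sup>2 + 1 / (2 * t) * (cmod (g z))\<^sup>2"
      using t by (simp add: norm_mult field_simps power2_eq_square)
  qed
  then show ?thesis using int by simp
qed

lemma L2inner_cnj: "L2inner g f = cnj (L2inner f g)"
  unfolding L2inner_def by (subst integral_bounded_linear'[OF bounded_linear_cnj bounded_linear_cnj, symmetric]) (simp_all add: mult.commute)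

lemma L2inner_sum_left:
  assumes "\<And>i. i \<in> I \<Longrightarrow> b i \<in> L2D" "k \<in> L2D"
  shows "L2inner (\<lambda>z. \<Sum>i\<in>I. c i * b i z) k = (\<Sum>i\<in>I. c i * L2inner (b i) k)"
proof -
  have "L2inner (\<lambda>z. \<Sum>i\<in>I. c i * b i z) k = (\<integral>z. (\<Sum>i\<in>I. c i * (b i z * cnj (k z))) \<partial>dA)"
    unfolding L2inner_def by (simp only: sum_distrib_right mult.assoc)
  also have "\<dots> = (\<Sum>i\<in>I. \<integral>z. c i * (b i z * cnj (k z)) \<partial>dA)"
    by (intro Bochner_Integration.integral_sum integrable_mult_right L2D_inner_integrable assms)
  also have "\<dots> = (\<Sum>i\<in>I. c i * L2inner (b i) k)"
    unfolding L2inner_def by (intro sum.cong refl integral_mult_right_zero)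
  finally show ?thesis .
qed

lemma bergman_sum:
  "(\<And>i. i < n \<Longrightarrow> b i \<in> bergman) \<Longrightarrow> (\<lambda>z. \<Sum>i<n. c i * b i z) \<in> bergman" for n :: nat
proof (induction n)
  case 0
  show ?case by (rule bergmanI) auto
next
  case (Suc n)
  have "(\<lambda>z. c n * b n z) \<in> bergman"
    by (rule bergman_mult) (use Suc.prems in auto)
  with Suc show ?case by (simp add: bergman_add)
qed

text \<open>The adjoint operator is multiplication by the conjugate symbol followed by the projection, and
  the projection does not increase norms.\<close>

lemma range_inner_bound:
  fixes n :: nat
  assumes p: "p holomorphic_on ball 0 1" "continuous_on (cball 0 1) p"
    and f: "f \<in> bergman" and b: "\<And>i. i < n \<Longrightarrow> b i \<in> bergman" and h: "h \<in> bergman"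
    and g: "\<And>z. z \<in> ball 0 1 \<Longrightarrow>
      g z = toeplitz (\<lambda>z. cnj z + p z) f z - l * f z + (\<Sum>i<n. c i * b i z)"
    and \<epsilon>: "\<epsilon> > 0" and small: "(\<integral>z. (cmod ((cnj z + p z - l) * h z))\<^sup>2 \<partial>dA) \<le> \<epsilon>\<^sup>2"
      "\<And>i. i < n \<Longrightarrow> cmod (L2inner (b i) h) \<le> \<epsilon>"
  shows "cmod (L2inner g h) \<le> (((\<integral>z. (cmod (f z))\<^sup>2 \<partial>dA) + 1) / 2 + (\<Sum>i<n. cmod (c i))) * \<epsilon>"
proof -
  let ?T = "toeplitz (\<lambda>z. cnj z + p z) f" and ?\<psi> = "\<lambda>z. cnj z + p z - l"
  have hL: "h \<in> L2D" and fL: "f \<in> L2D" by (rule bergmanD[OF h] bergmanD[OF f])+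
  obtain B where B: "\<And>z. z \<in> ball 0 1 \<Longrightarrow> cmod (cnj z + p z) \<le> B"
    using toeplitz_symbol_bounded[OF p(2)] by blast
  have pm [measurable]: "p \<in> borel_measurable dA" by (rule holomorphic_measurable_dA[OF p(1)])
  have phi: "(\<lambda>z. (cnj z + p z) * f z) \<in> L2D"
    by (rule L2D_bounded_mult[OF fL _ B]) measurable
  have lf: "(\<lambda>z. l * f z) \<in> L2D"
    by (rule L2D_bounded_mult[OF fL, where B = "cmod l"]) auto
  have "cmod (cnj (?\<psi> z)) \<le> B + cmod l" if "z \<in> ball 0 1" for z
    unfolding complex_mod_cnj using B[OF that] norm_triangle_ineq4[of "cnj z + p z" l] by linarith
  then have psih: "(\<lambda>z. cnj (?\<psi> z) * h z) \<in> L2D"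
    by (intro L2D_bounded_mult[OF hL, where B = "B + cmod l"]) auto
  have sumL: "(\<lambda>z. \<Sum>i<n. c i * b i z) \<in> L2D"
    using bergman_sum[of n b c] b bergmanD(4) by blast
  have TL: "?T \<in> L2D" by (intro bergmanD toeplitz_bergman p f)
  have diffL: "(\<lambda>z. ?T z - l * f z) \<in> L2D"
  proof -
    have "(\<lambda>z. l * f z) \<in> bergman" by (rule bergman_mult[OF _ _ f]) auto
    then show ?thesis by (intro bergmanD(4) bergman_diff toeplitz_bergman p f)
  qed
  have "L2inner g h = L2inner (\<lambda>z. (?T z - l * f z) + (\<Sum>i<n. c i * b i z)) h"
    unfolding L2inner_def using g by (intro Bochner_Integration.integral_cong refl) simp
  also have "\<dots> = L2inner (\<lambda>z. ?T z - l * f z) h + L2inner (\<lambda>z. \<Sum>i<n. c i * b i z) h"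
    by (rule L2inner_add_left[OF diffL sumL hL])
  also have "L2inner (\<lambda>z. ?T z - l * f z) h = L2inner (\<lambda>z. (cnj z + p z) * f z) h - L2inner (\<lambda>z. l * f z) h"
    by (simp only: L2inner_diff_left[OF TL lf hL] toeplitz_inner[OF p f h])
  also have "\<dots> = L2inner (\<lambda>z. (cnj z + p z) * f z - l * f z) h"
    by (rule L2inner_diff_left[OF phi lf hL, symmetric])
  also have "\<dots> = L2inner f (\<lambda>z. cnj (?\<psi> z) * h z)"
    unfolding L2inner_def by (simp add: algebra_simps)
  also have "L2inner (\<lambda>z. \<Sum>i<n. c i * b i z) h = (\<Sum>i<n. c i * L2inner (b i) h)"
    by (rule L2inner_sum_left) (use b hL bergmanD in auto)
  finally have eq: "L2inner g h = L2inner f (\<lambda>z. cnj (?\<psi> z) * h z) + (\<Sum>i<n. c i * L2inner (b i) h)" .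
  have "cmod (L2inner f (\<lambda>z. cnj (?\<psi> z) * h z)) \<le> (\<integral>z. cmod (f z * cnj (cnj (?\<psi> z) * h z)) \<partial>dA)"
    unfolding L2inner_def by (rule integral_norm_bound)
  \<comment> \<open>With weight \<epsilon> both terms become linear in \<epsilon>, since the second
    integral is at most \<epsilon>^2; what remains in the constant is the norm of f.\<close>
  also have "\<dots> \<le> \<epsilon> / 2 * (\<integral>z. (cmod (f z))\<^sup>2 \<partial>dA) + 1 / (2 * \<epsilon>) * (\<integral>z. (cmod (cnj (?\<psi> z) * h z))\<^sup>2 \<partial>dA)"
    by (rule integral_mult_le_squares[OF fL psih \<epsilon>])
  also have "(\<integral>z. (cmod (cnj (?\<psi> z) * h z))\<^sup>2 \<partial>dA) = (\<integral>z. (cmod (?\<psi> z * h z))\<^sup>2 \<partial>dA)"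
    by (simp only: norm_mult complex_mod_cnj)
  also have "\<epsilon> / 2 * (\<integral>z. (cmod (f z))\<^sup>2 \<partial>dA) + 1 / (2 * \<epsilon>) * \<dots> \<le>
      \<epsilon> / 2 * (\<integral>z. (cmod (f z))\<^sup>2 \<partial>dA) + 1 / (2 * \<epsilon>) * \<epsilon>\<^sup>2"
    using small(1) \<epsilon> by (intro add_left_mono mult_left_mono) auto
  also have "1 / (2 * \<epsilon>) * \<epsilon>\<^sup>2 = \<epsilon> / 2" using \<epsilon> by (simp add: power2_eq_square)
  finally have 1: "cmod (L2inner f (\<lambda>z. cnj (?\<psi> z) * h z)) \<le> \<epsilon> / 2 * (\<integral>z. (cmod (f z))\<^sup>2 \<partial>dA) + \<epsilon> / 2" .
  have "cmod (\<Sum>i<n. c i * L2inner (b i) h) \<le> (\<Sum>i<n. cmod (c i) * \<epsilon>)"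
    by (rule sum_norm_le) (use small(2) in \<open>auto simp: norm_mult intro!: mult_left_mono\<close>)
  then have "cmod (L2inner g h) \<le> (\<epsilon> / 2 * (\<integral>z. (cmod (f z))\<^sup>2 \<partial>dA) + \<epsilon> / 2) + (\<Sum>i<n. cmod (c i)) * \<epsilon>"
    unfolding eq sum_distrib_right using 1 norm_triangle_mono by blast
  then show ?thesis by (simp add: algebra_simps add_divide_distrib)
qed

section \<open>Almost orthogonal test functions, almost annihilated by the symbol\<close>

lemma exists_test_function:
  assumes \<zeta>: "cmod \<zeta> = 1" and \<psi>: "continuous_on (cball 0 1) \<psi>" "\<psi> \<zeta> = 0"
    and S: "finite S" "S \<subseteq> bergman" and \<epsilon>: "\<epsilon> > 0" and \<rho>: "\<rho> < 1"
  shows "\<exists>h\<in>bergman. (\<integral>z. (cmod (h z))\<^sup>2 \<partial>dA) = 1 \<and> (\<integral>z. (cmod (\<psi> z * h z))\<^sup>2 \<partial>dA) \<le> \<epsilon>\<^sup>2 \<and>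
    (\<forall>s\<in>S. cmod (L2inner s h) \<le> \<epsilon>) \<and> (\<forall>z\<in>cball 0 \<rho>. cmod (h z) \<le> 1)"
proof -
  have "eventually (\<lambda>N. (\<integral>z. (cmod (\<psi> z * peak_fun \<zeta> N z))\<^sup>2 \<partial>dA) < \<epsilon>\<^sup>2) sequentially"
    using \<epsilon> by (intro order_tendstoD(2)[OF peak_fun_mult_tendsto_0[OF \<zeta> \<psi>]]) auto
  \<comment> \<open>Weak convergence gives a threshold for each s separately; a common one exists
    because S is finite.\<close>
  moreover have "eventually (\<lambda>N. \<forall>s\<in>S. cmod (L2inner s (peak_fun \<zeta> N)) < \<epsilon>) sequentially"
  proof (rule eventually_ball_finite[OF S(1)], intro ballI)
    fix s assume "s \<in> S"
    then have "(\<lambda>N. L2inner s (peak_fun \<zeta> N)) \<longlonglongrightarrow> 0"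
      using S bergmanD(4) by (intro peak_fun_weakly_null \<zeta>) auto
    then have "(\<lambda>N. cmod (L2inner s (peak_fun \<zeta> N))) \<longlonglongrightarrow> 0" by (rule tendsto_norm_zero)
    then show "eventually (\<lambda>N. cmod (L2inner s (peak_fun \<zeta> N)) < \<epsilon>) sequentially"
      using \<epsilon> by (rule order_tendstoD(2))
  qed
  ultimately have "eventually (\<lambda>N. (\<integral>z. (cmod (\<psi> z * peak_fun \<zeta> N z))\<^sup>2 \<partial>dA) < \<epsilon>\<^sup>2 \<and>
      (\<forall>s\<in>S. cmod (L2inner s (peak_fun \<zeta> N)) < \<epsilon>) \<and>
      (\<forall>z\<in>cball 0 \<rho>. cmod (peak_fun \<zeta> N z) \<le> 1)) sequentially"
    using peak_fun_locally_bounded[OF \<zeta> \<rho>] by eventually_elim blast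
  then obtain N where N: "(\<integral>z. (cmod (\<psi> z * peak_fun \<zeta> N z))\<^sup>2 \<partial>dA) < \<epsilon>\<^sup>2"
      "\<forall>s\<in>S. cmod (L2inner s (peak_fun \<zeta> N)) < \<epsilon>" "\<forall>z\<in>cball 0 \<rho>. cmod (peak_fun \<zeta> N z) \<le> 1"
    by (auto simp: eventually_sequentially)
  show ?thesis
  proof (intro bexI conjI)
    show "(\<integral>z. (cmod (\<psi> z * peak_fun \<zeta> N z))\<^sup>2 \<partial>dA) \<le> \<epsilon>\<^sup>2" using N(1) by simp
    show "\<forall>s\<in>S. cmod (L2inner s (peak_fun \<zeta> N)) \<le> \<epsilon>" using N(2) by (auto intro: less_imp_le)
  qed (use N(3) peak_fun_norm[OF \<zeta>] peak_fun_bergman[OF \<zeta>] in auto)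
qed

text \<open>Dependent choice. Smallness against all earlier functions is one more condition of the
  same kind as smallness against B, because at each stage only finitely many functions have been
  chosen.\<close>

lemma exists_test_sequence:
  assumes \<zeta>: "cmod \<zeta> = 1" and \<psi>: "continuous_on (cball 0 1) \<psi>" "\<psi> \<zeta> = 0"
    and B: "finite B" "B \<subseteq> bergman"
  obtains h :: "nat \<Rightarrow> complex \<Rightarrow> complex" where "\<And>n. h n \<in> bergman"
    "\<And>n. (\<integral>z. (cmod (h n z))\<^sup>2 \<partial>dA) = 1"
    "\<And>n. (\<integral>z. (cmod (\<psi> z * h n z))\<^sup>2 \<partial>dA) \<le> ((1 / 16) ^ n)\<^sup>2"
    "\<And>n b. b \<in> B \<Longrightarrow> cmod (L2inner b (h n)) \<le> (1 / 16) ^ n"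
    "\<And>n k. k < n \<Longrightarrow> cmod (L2inner (h k) (h n)) \<le> (1 / 16) ^ n"
    "\<And>n z. z \<in> cball 0 (disk_radius n) \<Longrightarrow> cmod (h n z) \<le> 1"
proof -
  define good where "good = (\<lambda>n S h. h \<in> bergman \<and> (\<integral>z. (cmod (h z))\<^sup>2 \<partial>dA) = 1 \<and>
    (\<integral>z. (cmod (\<psi> z * h z))\<^sup>2 \<partial>dA) \<le> ((1 / 16) ^ n)\<^sup>2 \<and>
    (\<forall>s\<in>S. cmod (L2inner s h) \<le> (1 / 16) ^ n) \<and> (\<forall>z\<in>cball 0 (disk_radius n). cmod (h z) \<le> 1))"
  have ex: "\<exists>h. good n S h" if "finite S" "S \<subseteq> bergman" for n S
    using exists_test_function[OF \<zeta> \<psi> that, of "(1 / 16) ^ n" "disk_radius n"] disk_radius(3)[of n]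
    unfolding good_def by auto
  \<comment> \<open>The state carries, besides the current function, the finite set S of everything
    it was tested against: B and all earlier functions. \<open>Q\<close> makes S grow by the
    function just chosen.\<close>
  define P where "P = (\<lambda>n (S, h). finite S \<and> S \<subseteq> bergman \<and> B \<subseteq> S \<and> good n S h)"
  define Q where "Q = (\<lambda>(n::nat) (S :: (complex \<Rightarrow> complex) set, h :: complex \<Rightarrow> complex)
    (S', h' :: complex \<Rightarrow> complex). S' = insert h S)"
  obtain h0 where "good 0 B h0" using ex[OF B] by blast
  then have "\<exists>x. P 0 x" using B by (intro exI[of _ "(B, h0)"]) (simp add: P_def)
  moreover have "\<exists>y. P (Suc n) y \<and> Q n x y" if "P n x" for n x
  proof -
    obtain S h where x: "x = (S, h)" by fastforce
    have S: "finite (insert h S)" "insert h S \<subseteq> bergman" "B \<subseteq> insert h S"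
      using that by (auto simp: x P_def good_def)
    obtain h' where "good (Suc n) (insert h S) h'" using ex[OF S(1,2)] by blast
    then show ?thesis
      using S by (intro exI[of _ "(insert h S, h')"]) (auto simp: P_def Q_def x)
  qed
  ultimately obtain x where x: "\<And>n. P n (x n)" "\<And>n. Q n (x n) (x (Suc n))"
    using dependent_nat_choice[of P Q] by blast
  define h where "h = (\<lambda>n. snd (x n))"
  have g: "good n (fst (x n)) (h n)" and B: "B \<subseteq> fst (x n)" for n
    using x(1)[of n] by (auto simp: P_def h_def split: prod.splits)
  have "fst (x (Suc n)) = insert (h n) (fst (x n))" for n
    using x(2)[of n] by (auto simp: Q_def h_def split: prod.splits)
  then have mem: "k < n \<Longrightarrow> h k \<in> fst (x n)" for k n
    by (induction n) (auto simp: less_Suc_eq)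
  show ?thesis
    by (rule that[of h]) (use g B mem in \<open>auto simp: good_def subset_iff\<close>)
qed

section \<open>A geometrically weighted series of test functions\<close>

lemma geometric_sums_quarter: "(\<lambda>k. (1 / 4 :: real) ^ k) sums (4 / 3)"
  using geometric_sums[of "1 / 4 :: real"] by simp

text \<open>On a compact subdisk all but finitely many \<open>h n\<close> are bounded by 1, so the
  series converges locally uniformly and its sum is holomorphic. Unit norms and the geometric
  weights give square integrability and permit pairing term by term.\<close>

lemma exists_lacunary_sum:
  fixes h :: "nat \<Rightarrow> complex \<Rightarrow> complex"
  assumes h: "\<And>n. h n \<in> bergman" "\<And>n. (\<integral>z. (cmod (h n z))\<^sup>2 \<partial>dA) = 1"
    and bd: "\<And>n z. z \<in> cball 0 (disk_radius n) \<Longrightarrow> cmod (h n z) \<le> 1"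
  obtains g where "g \<in> bergman" "\<And>n. (\<lambda>k. (1 / 4) ^ k * L2inner (h k) (h n)) sums L2inner g (h n)"
proof -
  have ev: "eventually (\<lambda>k. \<forall>z\<in>cball 0 \<rho>. cmod (h k z) \<le> 1) sequentially" if "\<rho> < 1" for \<rho>
    using order_tendstoD(1)[OF disk_radius(5) that]
    by eventually_elim (use bd in force)
  have quarter: "summable (\<lambda>k. (1 / 4 :: real) ^ k)"
    using geometric_sums_quarter by (rule sums_summable)
  have sum1: "summable (\<lambda>k. (1 / 4) ^ k * cmod (h k z))"
    and sum2: "summable (\<lambda>k. (1 / 4) ^ k * (cmod (h k z))\<^sup>2)" if "z \<in> ball 0 1" for z
  proof -
    have e: "eventually (\<lambda>k. cmod (h k z) \<le> 1) sequentially"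
      using ev[of "cmod z"] that by (auto elim!: eventually_mono)
    show "summable (\<lambda>k. (1 / 4) ^ k * cmod (h k z))"
      by (rule summable_comparison_test_ev[OF _ quarter])
        (use e in eventually_elim, simp add: mult_left_le)
    show "summable (\<lambda>k. (1 / 4) ^ k * (cmod (h k z))\<^sup>2)"
      by (rule summable_comparison_test_ev[OF _ quarter])
        (use e in eventually_elim, simp add: mult_left_le power_le_one)
  qed
  define g where "g = (\<lambda>z. if z \<in> ball 0 1 then \<Sum>k. (1 / 4) ^ k * h k z else 0)"
  have gsums: "(\<lambda>k. (1 / 4) ^ k * h k z) sums g z" if "z \<in> ball 0 1" for z
  proof -
    have "summable (\<lambda>k. cmod ((1 / 4) ^ k * h k z))"
      using sum1[OF that] by (simp add: norm_mult norm_power norm_divide)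
    then have "summable (\<lambda>k. (1 / 4) ^ k * h k z)" by (rule summable_norm_cancel)
    then show ?thesis using that by (simp add: g_def summable_sums)
  qed
  have hol: "g holomorphic_on ball 0 1"
  proof (rule holomorphic_uniform_sequence[where f = "\<lambda>n z. \<Sum>k<n. (1 / 4) ^ k * h k z"])
    show "(\<lambda>z. \<Sum>k<n. (1 / 4) ^ k * h k z) holomorphic_on ball 0 1" for n
      by (intro holomorphic_intros bergmanD(1) h)
    fix z :: complex assume z: "z \<in> ball 0 1"
    define d where "d = (1 - cmod z) / 2"
    have d: "d > 0" "cmod z + d < 1" using z by (auto simp: d_def field_simps)
    have sub: "cball z d \<subseteq> cball 0 (cmod z + d)"
    proof
      fix w assume "w \<in> cball z d"
      then have "cmod (w - z) \<le> d" by (simp add: dist_norm norm_minus_commute)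
      then show "w \<in> cball 0 (cmod z + d)"
        using norm_triangle_ineq[of z "w - z"] by simp
    qed
    then have sub1: "cball z d \<subseteq> ball 0 1" using d by auto
    have "uniform_limit (cball z d) (\<lambda>n z. \<Sum>k<n. (1 / 4) ^ k * h k z) (\<lambda>z. \<Sum>k. (1 / 4) ^ k * h k z) sequentially"
    proof (rule Weierstrass_m_test_ev[OF _ quarter])
      show "eventually (\<lambda>k. \<forall>w\<in>cball z d. cmod ((1 / 4) ^ k * h k w) \<le> (1 / 4) ^ k) sequentially"
        using ev[OF d(2)]
      proof eventually_elim
        case (elim k)
        show ?case
        proof
          fix w assume "w \<in> cball z d"
          then have "cmod (h k w) \<le> 1" using elim sub by blast
          then show "cmod ((1 / 4) ^ k * h k w) \<le> (1 / 4) ^ k"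
            by (simp add: norm_mult norm_power norm_divide mult_left_le)
        qed
      qed
    qed
    then have "uniform_limit (cball z d) (\<lambda>n z. \<Sum>k<n. (1 / 4) ^ k * h k z) g sequentially"
      by (rule uniform_limit_cong'[THEN iffD1, rotated 2]) (use sub1 in \<open>auto simp: g_def\<close>)
    with d sub1 show "\<exists>d>0. cball z d \<subseteq> ball 0 1 \<and>
        uniform_limit (cball z d) (\<lambda>n z. \<Sum>k<n. (1 / 4) ^ k * h k z) g sequentially" by blast
  qed auto
  note [measurable] = holomorphic_measurable_dA[OF hol]
  have [measurable]: "h k \<in> borel_measurable dA" for k by (rule bergmanD[OF h(1)])
  have "integrable dA (\<lambda>z. \<Sum>k. (1 / 4) ^ k * (cmod (h k z))\<^sup>2)"
  proof (rule integrable_suminf)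
    show "integrable dA (\<lambda>z. (1 / 4) ^ k * (cmod (h k z))\<^sup>2)" for k
      by (intro integrable_mult_right bergmanD h)
    show "AE z in dA. summable (\<lambda>k. norm ((1 / 4) ^ k * (cmod (h k z))\<^sup>2))"
      by (rule AE_I2) (use sum2 in simp)
    show "summable (\<lambda>k. \<integral>z. norm ((1 / 4) ^ k * (cmod (h k z))\<^sup>2) \<partial>dA)"
      using quarter by (simp add: h(2))
  qed
  then have int: "integrable dA (\<lambda>z. 4 / 3 * (\<Sum>k. (1 / 4) ^ k * (cmod (h k z))\<^sup>2))"
    by (rule integrable_mult_right)
  have "integrable dA (\<lambda>z. (cmod (g z))\<^sup>2)"
  proof (rule Bochner_Integration.integrable_bound[OF int])
    have "(cmod (g z))\<^sup>2 \<le> 4 / 3 * (\<Sum>k. (1 / 4) ^ k * (cmod (h k z))\<^sup>2)" if z: "z \<in> ball 0 1" for z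
    proof (rule LIMSEQ_le_const2)
      have "(\<lambda>n. \<Sum>k<n. (1 / 4) ^ k * h k z) \<longlonglongrightarrow> g z"
        using gsums[OF z] by (simp add: sums_def)
      then show "(\<lambda>n. (cmod (\<Sum>k<n. (1 / 4) ^ k * h k z))\<^sup>2) \<longlonglongrightarrow> (cmod (g z))\<^sup>2"
        by (intro tendsto_intros)
      have "(cmod (\<Sum>k<n. (1 / 4) ^ k * h k z))\<^sup>2 \<le> 4 / 3 * (\<Sum>k. (1 / 4) ^ k * (cmod (h k z))\<^sup>2)" for n
      proof -
        have "cmod (\<Sum>k<n. (1 / 4) ^ k * h k z) \<le> (\<Sum>k<n. (1 / 4) ^ k * cmod (h k z))"
          by (rule sum_norm_le) (simp add: norm_mult norm_power norm_divide)
        \<comment> \<open>Splitting the weight 1/4^k evenly between the factors of Cauchy-Schwarz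
          leaves a geometric sum below 4/3 and a series of squares that still has the summable
          weight 1/4^k.\<close>
        also have "\<dots> = (\<Sum>k<n. (1 / 2) ^ k * ((1 / 2) ^ k * cmod (h k z)))"
          by (intro sum.cong refl) (simp flip: power_mult_distrib mult.assoc)
        finally have "(cmod (\<Sum>k<n. (1 / 4) ^ k * h k z))\<^sup>2 \<le>
            (\<Sum>k<n. (1 / 2) ^ k * ((1 / 2) ^ k * cmod (h k z)))\<^sup>2"
          by (intro power_mono) auto
        also have "\<dots> \<le> (\<Sum>k<n. ((1 / 2) ^ k)\<^sup>2) * (\<Sum>k<n. ((1 / 2) ^ k * cmod (h k z))\<^sup>2)"
          by (rule Cauchy_Schwarz_ineq_sum)
        also have "\<dots> = (\<Sum>k<n. (1 / 4) ^ k) * (\<Sum>k<n. (1 / 4) ^ k * (cmod (h k z))\<^sup>2)"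
        proof -
          have "((1 / 2 :: real) ^ k)\<^sup>2 = (1 / 4) ^ k" for k
            by (subst power_mult[symmetric], subst mult.commute, subst power_mult) (simp add: power2_eq_square)
          then show ?thesis by (simp add: power_mult_distrib)
        qed
        also have "\<dots> \<le> 4 / 3 * (\<Sum>k. (1 / 4) ^ k * (cmod (h k z))\<^sup>2)"
        proof (intro mult_mono sum_le_suminf sum2 z)
          show "(\<Sum>k<n. (1 / 4 :: real) ^ k) \<le> 4 / 3"
            using sum_le_suminf[OF quarter, of "{..<n}"] geometric_sums_quarter by (simp add: sums_iff)
        qed (auto intro: sum_nonneg)
        finally show ?thesis .
      qed
      then show "\<exists>N. \<forall>n\<ge>N. (cmod (\<Sum>k<n. (1 / 4) ^ k * h k z))\<^sup>2 \<le>
          4 / 3 * (\<Sum>k. (1 / 4) ^ k * (cmod (h k z))\<^sup>2)" by blast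
    qed
    then show "AE z in dA. norm ((cmod (g z))\<^sup>2) \<le> norm (4 / 3 * (\<Sum>k. (1 / 4) ^ k * (cmod (h k z))\<^sup>2))"
      by (intro AE_I2) (auto intro: order_trans[OF _ abs_ge_self])
  qed measurable
  then have g: "g \<in> bergman"
    using hol by (intro bergmanI) (auto simp: g_def)
  have "(\<lambda>k. (1 / 4) ^ k * L2inner (h k) (h n)) sums L2inner g (h n)" for n
  proof -
    define F where "F = (\<lambda>k z. (1 / 4) ^ k * (h k z * cnj (h n z)))"
    have intF: "integrable dA (F k)" for k
      unfolding F_def by (intro integrable_mult_right L2D_inner_integrable bergmanD h)
    have nF: "cmod (F k z) = (1 / 4) ^ k * cmod (h k z * cnj (h n z))" for k z
      by (simp add: F_def norm_mult norm_power norm_divide)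
    have "(\<lambda>k. integral\<^sup>L dA (F k)) sums (\<integral>z. (\<Sum>k. F k z) \<partial>dA)"
    proof (rule sums_integral[OF intF])
      show "AE z in dA. summable (\<lambda>k. norm (F k z))"
      proof (rule AE_I2)
        fix z assume "z \<in> space dA"
        then have "summable (\<lambda>k. (1 / 4) ^ k * cmod (h k z) * cmod (h n z))"
          by (intro summable_mult2 sum1) simp
        then show "summable (\<lambda>k. norm (F k z))" by (simp add: nF norm_mult mult.assoc)
      qed
      have le: "(\<integral>z. norm (F k z) \<partial>dA) \<le> (1 / 4) ^ k" for k
      proof -
        have "(\<integral>z. cmod (h k z * cnj (h n z)) \<partial>dA) \<le> 1 / 2 * 1 + 1 / (2 * 1) * 1"
          using integral_mult_le_squares[of "h k" "h n" 1] bergmanD(4)[OF h(1)] h(2) by simp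
        then have "(\<integral>z. cmod (h k z * cnj (h n z)) \<partial>dA) \<le> 1" by simp
        then show ?thesis by (simp add: nF mult_left_le)
      qed
      show "summable (\<lambda>k. \<integral>z. norm (F k z) \<partial>dA)"
        by (rule summable_comparison_test'[OF quarter]) (use le in simp)
    qed
    moreover have "integral\<^sup>L dA (F k) = (1 / 4) ^ k * L2inner (h k) (h n)" for k
      unfolding F_def L2inner_def by (rule integral_mult_right_zero)
    moreover have "(\<integral>z. (\<Sum>k. F k z) \<partial>dA) = L2inner g (h n)"
      unfolding L2inner_def
    proof (intro Bochner_Integration.integral_cong refl)
      fix z assume "z \<in> space dA"
      then have "(\<lambda>k. (1 / 4) ^ k * h k z * cnj (h n z)) sums (g z * cnj (h n z))"
        by (intro sums_mult2 gsums) simp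
      then show "(\<Sum>k. F k z) = g z * cnj (h n z)" by (simp add: F_def sums_iff mult.assoc)
    qed
    ultimately show ?thesis by simp
  qed
  with g show ?thesis by (rule that)
qed

lemma fredholm_imp_symbol_nonzero:
  assumes p: "p holomorphic_on ball 0 1" "continuous_on (cball 0 1) p"
    and fred: "fredholm_on_bergman (toeplitz (\<lambda>z. cnj z + p z)) l" and \<zeta>: "cmod \<zeta> = 1"
  shows "1 + \<zeta> * (p \<zeta> - l) \<noteq> 0"
proof
  assume zero: "1 + \<zeta> * (p \<zeta> - l) = 0"
  define \<psi> where "\<psi> = (\<lambda>z. cnj z + p z - l)"
  have "cnj \<zeta> * \<zeta> = 1"
    using complex_norm_square[of \<zeta>] \<zeta> by (simp add: mult.commute)
  \<comment> \<open>On the circle \<open>cnj \<zeta>\<close> is the inverse of \<zeta>, so zeros of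
    q there are zeros of the continuous symbol minus l.\<close>
  then have "\<psi> \<zeta> = cnj \<zeta> * (1 + \<zeta> * (p \<zeta> - l))"
    by (simp add: \<psi>_def distrib_left flip: mult.assoc)
  then have \<psi>: "continuous_on (cball 0 1) \<psi>" "\<psi> \<zeta> = 0"
    unfolding zero by (auto simp: \<psi>_def intro!: continuous_intros p)
  obtain n b where b: "\<forall>i<n. b i \<in> bergman" and
    ran: "\<forall>g\<in>bergman. \<exists>f\<in>bergman. \<exists>c::nat \<Rightarrow> complex.
       \<forall>z\<in>ball 0 1. g z = toeplitz (\<lambda>z. cnj z + p z) f z - l * f z + (\<Sum>i<n. c i * b i z)"
    using fred unfolding fredholm_on_bergman_def by (elim conjE exE) (rule that)
  have B: "finite (b ` {..<n})" "b ` {..<n} \<subseteq> bergman" using b by auto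
  obtain h where h: "\<And>n. h n \<in> bergman"
    "\<And>n. (\<integral>z. (cmod (h n z))\<^sup>2 \<partial>dA) = 1"
    "\<And>n. (\<integral>z. (cmod (\<psi> z * h n z))\<^sup>2 \<partial>dA) \<le> ((1 / 16) ^ n)\<^sup>2"
    "\<And>m b'. b' \<in> b ` {..<n} \<Longrightarrow> cmod (L2inner b' (h m)) \<le> (1 / 16) ^ m"
    "\<And>n k. k < n \<Longrightarrow> cmod (L2inner (h k) (h n)) \<le> (1 / 16) ^ n"
    "\<And>n z. z \<in> cball 0 (disk_radius n) \<Longrightarrow> cmod (h n z) \<le> 1"
    using exists_test_sequence[OF \<zeta> \<psi> B] by blast
  obtain g where g: "g \<in> bergman" "\<And>n. (\<lambda>k. (1 / 4) ^ k * L2inner (h k) (h n)) sums L2inner g (h n)"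
    using exists_lacunary_sum[of h] h(1,2,6) by metis
  obtain f c where f: "f \<in> bergman" and fc: "\<And>z. z \<in> ball 0 1 \<Longrightarrow>
      g z = toeplitz (\<lambda>z. cnj z + p z) f z - l * f z + (\<Sum>i<n. c i * b i z)"
    using ran g(1) by blast
  define C where "C = ((\<integral>z. (cmod (f z))\<^sup>2 \<partial>dA) + 1) / 2 + (\<Sum>i<n. cmod (c i))"
  \<comment> \<open>Here g is represented as an element of the range plus the span of the
    \<open>b i\<close>; C depends on this representation but not on m.\<close>
  have upper: "cmod (L2inner g (h m)) \<le> C * (1 / 16) ^ m" for m
    unfolding C_def
    by (rule range_inner_bound[OF p f _ h(1) fc]) (use b h(3,4) in \<open>auto simp: \<psi>_def\<close>)
  \<comment> \<open>The diagonal term contributes exactly 1 / 4^m; the cross terms carry the factor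
    1 / 16^m and their weights sum to at most 4/3.\<close>
  have lower: "cmod (L2inner g (h m) - (1 / 4) ^ m) \<le> 4 / 3 * (1 / 16) ^ m" for m
  proof -
    let ?d = "\<lambda>k. (1 / 4) ^ k * L2inner (h k) (h m) - (if k = m then (1 / 4) ^ m else 0)"
    have sums: "?d sums (L2inner g (h m) - (1 / 4) ^ m)"
      by (intro sums_diff g sums_single)
    have cross: "cmod (L2inner (h k) (h m)) \<le> (1 / 16) ^ m" if "k \<noteq> m" for k
    proof (cases "k < m")
      case True
      then show ?thesis by (rule h(5))
    next
      case False
      \<comment> \<open>For k > m the later function is \<open>h k\<close>, so conjugate symmetry
        gives the better bound 1 / 16^k.\<close>
      then have "cmod (L2inner (h m) (h k)) \<le> (1 / 16) ^ k" using that by (intro h(5)) auto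
      also have "\<dots> \<le> (1 / 16) ^ m" using False by (intro power_decreasing) auto
      finally show ?thesis by (subst L2inner_cnj) simp
    qed
    have self: "L2inner (h m) (h m) = 1"
    proof -
      have "L2inner (h m) (h m) = of_real (\<integral>z. (cmod (h m z))\<^sup>2 \<partial>dA)"
        unfolding L2inner_def complex_norm_square[symmetric] by (rule integral_complex_of_real)
      then show ?thesis by (simp add: h(2))
    qed
    have le: "cmod (?d k) \<le> (1 / 4) ^ k * (1 / 16) ^ m" for k
      using cross[of k] by (auto simp: self norm_mult norm_power norm_divide)
    have "cmod (suminf ?d) \<le> (\<Sum>k. (1 / 4) ^ k * (1 / 16) ^ m)"
      by (rule norm_suminf_le[OF le]) (intro summable_mult2 sums_summable[OF geometric_sums_quarter])
    also have "\<dots> = 4 / 3 * (1 / 16) ^ m"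
      using sums_mult2[OF geometric_sums_quarter, of "(1 / 16) ^ m"] by (simp add: sums_iff)
    finally show ?thesis using sums by (simp add: sums_iff)
  qed
  \<comment> \<open>Comparing \<open>upper\<close> with \<open>lower\<close> and multiplying by 16^m
    leaves 4^m bounded in m.\<close>
  have "4 ^ m \<le> C + 4 / 3" for m :: nat
  proof -
    have "(1 / 4) ^ m = cmod ((1 / 4) ^ m)" by (simp add: norm_power norm_divide)
    also have "\<dots> \<le> cmod (L2inner g (h m)) + cmod (L2inner g (h m) - (1 / 4) ^ m)"
      by (metis add.commute norm_minus_commute norm_triangle_sub)
    also have "\<dots> \<le> (C + 4 / 3) * (1 / 16) ^ m"
      using upper[of m] lower[of m] by (simp add: algebra_simps)
    finally have "(1 / 4) ^ m * 16 ^ m \<le> (C + 4 / 3) * (1 / 16) ^ m * (16 :: real) ^ m"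
      by (intro mult_right_mono) auto
    then show ?thesis by (simp add: mult.assoc flip: power_mult_distrib)
  qed
  moreover obtain m :: nat where "C + 4 / 3 < 4 ^ m"
    using real_arch_pow[of 4 "C + 4 / 3"] by auto
  ultimately show False by (meson not_less)
qed

section \<open>The eigenvalue equation as a differential equation\<close>

lemma taylor_coeff_primitive:
  assumes F: "\<And>z. z \<in> ball 0 1 \<Longrightarrow> (F has_field_derivative f z) (at z)"
  shows "taylor_coeff F (Suc n) = taylor_coeff f n / of_nat (Suc n)"
proof -
  have "eventually (\<lambda>z. z \<in> ball 0 1) (nhds (0 :: complex))"
    by (rule eventually_nhds_in_open) auto
  then have "eventually (\<lambda>z. deriv F z = f z) (nhds 0)"
    by eventually_elim (use F DERIV_imp_deriv in blast)
  then have "(deriv ^^ n) (deriv F) 0 = (deriv ^^ n) f 0"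
    by (rule higher_deriv_cong_ev) simp
  then show ?thesis
    unfolding taylor_coeff_def by (simp add: funpow_swap1 divide_simps mult_ac)
qed

text \<open>Coefficientwise this is 1 - 1 / (n + 2) = (n + 1) / (n + 2). The lowest terms of z f and
  F cancel, so both sides start with z^2; the multiplied form avoids a division at the
  origin.\<close>

lemma backshift_primitive:
  assumes F: "\<And>z. z \<in> ball 0 1 \<Longrightarrow> (F has_field_derivative f z) (at z)" and F0: "F 0 = 0"
    and f: "f holomorphic_on ball 0 1" and z: "z \<in> ball 0 1"
  shows "z\<^sup>2 * backshift f z = z * f z - F z"
proof -
  have "F holomorphic_on ball 0 1"
    using F holomorphic_on_open[OF open_ball] by blast
  from taylor_sums[OF this z] have "(\<lambda>n. taylor_coeff F (Suc n) * z ^ Suc n) sums F z"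
    using sums_Suc_iff[of "\<lambda>n. taylor_coeff F n * z ^ n" "F z"] F0 by (simp add: taylor_coeff_def)
  moreover have "taylor_coeff F (Suc n) = taylor_coeff f n / of_nat (Suc n)" for n
    by (rule taylor_coeff_primitive) (rule F)
  ultimately have "(\<lambda>n. taylor_coeff f n / of_nat (Suc n) * z ^ Suc n) sums F z"
    by (simp only:)
  then have "(\<lambda>n. z * (taylor_coeff f n * z ^ n) - taylor_coeff f n / of_nat (Suc n) * z ^ Suc n) sums (z * f z - F z)"
    by (intro sums_diff sums_mult taylor_sums f z)
  then have "(\<lambda>n. z * (taylor_coeff f (Suc n) * z ^ Suc n) - taylor_coeff f (Suc n) / of_nat (Suc (Suc n)) * z ^ Suc (Suc n))
      sums (z * f z - F z)"
    using sums_Suc_iff[of "\<lambda>n. z * (taylor_coeff f n * z ^ n) - taylor_coeff f n / of_nat (Suc n) * z ^ Suc n" "z * f z - F z"]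
    by simp
  moreover have "z * (taylor_coeff f (Suc n) * z ^ Suc n) - taylor_coeff f (Suc n) / of_nat (Suc (Suc n)) * z ^ Suc (Suc n) =
      z\<^sup>2 * (backshift_coeff f n * z ^ n)" for n
  proof -
    have "1 - 1 / of_nat (Suc (Suc n)) = (of_nat (n + 1) / of_nat (n + 2) :: complex)"
    proof -
      have "of_nat (n + 2) \<noteq> (0 :: complex)" by (simp only: of_nat_eq_0_iff)
      then show ?thesis by (simp add: field_simps)
    qed
    then have "z\<^sup>2 * (backshift_coeff f n * z ^ n) =
        z\<^sup>2 * z ^ n * taylor_coeff f (Suc n) * (1 - 1 / of_nat (Suc (Suc n)))"
      unfolding backshift_coeff_def by (simp only: mult_ac)
    then show ?thesis by (simp add: power2_eq_square algebra_simps)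
  qed
  moreover have "(\<lambda>n. z\<^sup>2 * (backshift_coeff f n * z ^ n)) sums (z\<^sup>2 * backshift f z)"
    by (intro sums_mult backshift_sums f z)
  ultimately show ?thesis by (simp only: sums_unique2)
qed

text \<open>The eigenvalue equation times z^2 is the differential equation. The factor z^2 loses
  information only at the origin, where continuity of d restores it.\<close>

lemma eigenfunction_iff_ode:
  assumes p: "p holomorphic_on ball 0 1" "continuous_on (cball 0 1) p" and f: "f \<in> bergman"
    and F: "\<And>z. z \<in> ball 0 1 \<Longrightarrow> (F has_field_derivative f z) (at z)" and F0: "F 0 = 0"
  shows "(\<forall>z\<in>ball 0 1. toeplitz (\<lambda>z. cnj z + p z) f z = l * f z) \<longleftrightarrow>
    (\<forall>z\<in>ball 0 1. z * (1 + z * (p z - l)) * f z = F z)"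
proof -
  define d where "d = (\<lambda>z. backshift f z + p z * f z - l * f z)"
  have fh: "f holomorphic_on ball 0 1" by (rule bergmanD[OF f])
  have d: "z\<^sup>2 * d z = z * (1 + z * (p z - l)) * f z - F z" if "z \<in> ball 0 1" for z
  proof -
    have "z\<^sup>2 * d z = z\<^sup>2 * backshift f z + z\<^sup>2 * (p z - l) * f z"
      unfolding d_def by (simp add: algebra_simps)
    also have "z\<^sup>2 * backshift f z = z * f z - F z"
      by (rule backshift_primitive[OF F F0 fh that])
    finally show ?thesis by (simp add: power2_eq_square algebra_simps)
  qed
  have "d holomorphic_on ball 0 1"
    unfolding d_def by (intro holomorphic_intros backshift_holomorphic fh p)
  then have "continuous_on (ball 0 1) d" by (rule holomorphic_on_imp_continuous_on)
  then have cont: "isCont d 0" by (simp add: continuous_on_eq_continuous_at)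
  have "d 0 = 0" if "\<And>z. z \<in> ball 0 1 \<Longrightarrow> z\<^sup>2 * d z = 0"
  proof -
    have "eventually (\<lambda>z. z \<in> ball 0 1 - {0}) (at (0 :: complex))"
      by (intro eventually_at_in_open) auto
    then have "eventually (\<lambda>z. d z = 0) (at 0)"
      by eventually_elim (use that in force)
    then have "(d \<longlongrightarrow> 0) (at 0)" by (rule tendsto_eventually)
    with cont show ?thesis unfolding isCont_def by (intro tendsto_unique[of "at 0" d]) auto
  qed
  then have "(\<forall>z\<in>ball 0 1. d z = 0) \<longleftrightarrow> (\<forall>z\<in>ball 0 1. z\<^sup>2 * d z = 0)"
    by (metis mult_eq_0_iff mult_zero_right power_eq_0_iff)
  moreover have "(\<forall>z\<in>ball 0 1. toeplitz (\<lambda>z. cnj z + p z) f z = l * f z) \<longleftrightarrow> (\<forall>z\<in>ball 0 1. d z = 0)"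
    by (simp add: toeplitz_eq[OF p f] d_def)
  moreover have "(\<forall>z\<in>ball 0 1. z\<^sup>2 * d z = 0) \<longleftrightarrow> (\<forall>z\<in>ball 0 1. z * (1 + z * (p z - l)) * f z = F z)"
    by (intro ball_cong refl) (simp only: d right_minus_eq)
  ultimately show ?thesis by blast
qed

lemma exists_primitive:
  assumes "f holomorphic_on ball 0 1"
  obtains F where "\<And>z. z \<in> ball 0 1 \<Longrightarrow> (F has_field_derivative f z) (at z)" "F 0 = (0 :: complex)"
proof -
  obtain G where G: "\<And>z. z \<in> ball 0 1 \<Longrightarrow> (G has_field_derivative f z) (at z within ball 0 1)"
    using holomorphic_convex_primitive'[OF convex_ball open_ball assms] by blast
  have "((\<lambda>z. G z - G 0) has_field_derivative f z) (at z)" if "z \<in> ball 0 1" for z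
    using G[OF that] that by (auto intro!: derivative_eq_intros simp: at_within_open[OF _ open_ball])
  then show ?thesis by (intro that[of "\<lambda>z. G z - G 0"]) auto
qed

text \<open>Here \<open>n\<close> is the order of vanishing of \<open>F\<close> at \<open>w\<close>.\<close>

lemma ode_zero_order:
  assumes F: "\<And>z. z \<in> ball 0 1 \<Longrightarrow> (F has_field_derivative f z) (at z)"
    and ode: "\<And>z. z \<in> ball 0 1 \<Longrightarrow> s z * f z = F z"
    and s: "s holomorphic_on ball 0 1" and w: "w \<in> ball 0 1" "s w = 0"
    and nz: "z0 \<in> ball 0 1" "F z0 \<noteq> (0 :: complex)"
  obtains n :: nat where "n > 0" "of_nat n * deriv s w = 1"
proof -
  have Fh: "F holomorphic_on ball 0 1" using F holomorphic_on_open[OF open_ball] by blast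
  have Fw: "F w = 0" using ode[OF w(1)] w by simp
  have "\<not> F constant_on ball 0 1" using Fw nz w by (metis constant_on_def)
  then obtain g r n where n: "0 < n" and r: "0 < r" "ball w r \<subseteq> ball 0 1"
    and g: "g holomorphic_on ball w r" "\<And>z. z \<in> ball w r \<Longrightarrow> F z = (z - w) ^ n * g z"
      "\<And>z. z \<in> ball w r \<Longrightarrow> g z \<noteq> 0"
    using holomorphic_factor_zero_nonconstant[OF Fh open_ball connected_ball w(1) Fw] by metis
  \<comment> \<open>The product rule applied to F = (z - w)^n g, after cancelling (z - w)^(n - 1).
    Each factor now has a limit at w, the quotient \<open>s z / (z - w)\<close> tending to s'(w), so
    that n s'(w) g(w) = g(w) with g(w) nonzero.\<close>
  have eq: "s z / (z - w) * (of_nat n * g z + (z - w) * deriv g z) = g z" if z: "z \<in> ball w r" "z \<noteq> w" for z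
  proof -
    obtain k where k: "n = Suc k" using n gr0_implies_Suc by blast
    have "(g has_field_derivative deriv g z) (at z)"
      using g(1) z holomorphic_derivI open_ball by blast
    moreover have "((\<lambda>z. (z - w) ^ n) has_field_derivative of_nat n * (z - w) ^ k) (at z)"
      unfolding k by (auto intro!: derivative_eq_intros simp del: power_Suc of_nat_Suc)
    ultimately have "((\<lambda>z. (z - w) ^ n * g z) has_field_derivative
        of_nat n * (z - w) ^ k * g z + deriv g z * (z - w) ^ n) (at z)"
      by (intro DERIV_mult)
    also have "of_nat n * (z - w) ^ k * g z + deriv g z * (z - w) ^ n =
        (z - w) ^ k * (of_nat n * g z + (z - w) * deriv g z)"
      by (simp add: k algebra_simps)
    finally have "((\<lambda>z. (z - w) ^ n * g z) has_field_derivative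
        (z - w) ^ k * (of_nat n * g z + (z - w) * deriv g z)) (at z)" .
    then have "(F has_field_derivative (z - w) ^ k * (of_nat n * g z + (z - w) * deriv g z)) (at z)"
      by (rule has_field_derivative_transform_within_open[OF _ open_ball z(1)]) (simp add: g(2))
    moreover have "(F has_field_derivative f z) (at z)" using F r z by blast
    ultimately have "f z = (z - w) ^ k * (of_nat n * g z + (z - w) * deriv g z)" by (metis DERIV_unique)
    moreover have "s z * f z = (z - w) ^ n * g z" using ode[of z] g(2)[OF z(1)] r z by auto
    ultimately have "(z - w) ^ k * (s z * (of_nat n * g z + (z - w) * deriv g z)) = (z - w) ^ k * ((z - w) * g z)"
      by (simp add: k mult_ac)
    then have "s z * (of_nat n * g z + (z - w) * deriv g z) = (z - w) * g z"
      using z(2) by simp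
    then show ?thesis using z(2) by (simp add: divide_simps mult_ac)
  qed
  have ws: "w \<in> ball w r" using r by simp
  have "(s has_field_derivative deriv s w) (at w)"
    using s w holomorphic_derivI open_ball by blast
  then have s': "((\<lambda>z. s z / (z - w)) \<longlongrightarrow> deriv s w) (at w)"
    by (simp add: has_field_derivative_iff w)
  have "isCont g w" "isCont (deriv g) w"
    using g(1) holomorphic_deriv[OF g(1) open_ball] ws
    by (meson continuous_on_eq_continuous_at holomorphic_on_imp_continuous_on open_ball)+
  then have g': "(g \<longlongrightarrow> g w) (at w)" "(deriv g \<longlongrightarrow> deriv g w) (at w)"
    by (simp_all add: isCont_def)
  have "((\<lambda>z. s z / (z - w) * (of_nat n * g z + (z - w) * deriv g z)) \<longlongrightarrow>
      deriv s w * (of_nat n * g w + (w - w) * deriv g w)) (at w)"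
    by (intro tendsto_intros s' g')
  moreover have "eventually (\<lambda>z. z \<in> ball w r - {w}) (at w)"
    by (intro eventually_at_in_open) (use ws in auto)
  then have "eventually (\<lambda>z. s z / (z - w) * (of_nat n * g z + (z - w) * deriv g z) = g z) (at w)"
    by eventually_elim (use eq in auto)
  ultimately have "(g \<longlongrightarrow> deriv s w * (of_nat n * g w + (w - w) * deriv g w)) (at w)"
    by (rule Lim_transform_eventually)
  then have "deriv s w * (of_nat n * g w) = g w"
    using g'(1) by (simp add: tendsto_unique[OF at_neq_bot])
  then have "of_nat n * deriv s w * g w = 1 * g w" by (simp only: mult_ac mult_1)
  then have "of_nat n * deriv s w = 1" using g(3)[OF ws] by (simp only: mult_cancel_right) simp
  with n show ?thesis by (rule that)
qed

section \<open>Zeros of the symbol and the construction of a bounded solution\<close>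

lemma finite_zeros_disk:
  fixes q :: "complex \<Rightarrow> complex"
  assumes q: "q holomorphic_on ball 0 1" "continuous_on (cball 0 1) q"
    and circle: "\<And>z. cmod z = 1 \<Longrightarrow> q z \<noteq> 0" and z0: "z0 \<in> ball 0 1" "q z0 \<noteq> 0"
  shows "finite {z \<in> ball 0 1. q z = 0}"
proof (rule ccontr)
  define Z where "Z = {z \<in> ball 0 1. q z = 0}"
  assume "infinite {z \<in> ball 0 1. q z = 0}"
  then have inf: "infinite Z" by (simp add: Z_def)
  \<comment> \<open>As q has no zeros on the circle, Z is also the zero set in the closed disk,
    hence compact. An infinite Z would then accumulate inside the open disk, against the identity
    theorem.\<close>
  have "Z = cball 0 1 \<inter> q -` {0}"
    using circle by (auto simp: Z_def less_le)
  moreover have "closed (cball 0 1 \<inter> q -` {0})"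
    by (rule continuous_closed_preimage[OF q(2)]) auto
  ultimately have "compact Z" by (auto simp: compact_eq_bounded_closed intro: bounded_subset[OF bounded_cball])
  then obtain x where x: "x \<in> Z" "x islimpt Z"
    using inf by (meson compact_eq_Bolzano_Weierstrass order_refl)
  have "q z0 = 0"
    by (rule analytic_continuation[OF q(1) open_ball connected_ball _ _ x(2)])
      (use x z0 in \<open>auto simp: Z_def\<close>)
  with z0 show False by simp
qed

text \<open>Points are removed one at a time. The extension across w agrees with f near every
  remaining point, apart from that point itself, so the limit condition passes on to the next
  stage.\<close>

lemma removable_singularities_finite:
  fixes f :: "complex \<Rightarrow> complex"
  assumes "finite K" "open S" "K \<subseteq> S" "f holomorphic_on S - K"
    and "\<And>w. w \<in> K \<Longrightarrow> ((\<lambda>z. (z - w) * f z) \<longlongrightarrow> 0) (at w)"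
  shows "\<exists>g. g holomorphic_on S \<and> (\<forall>z\<in>S - K. g z = f z)"
  using assms
proof (induction K arbitrary: f rule: finite_induct)
  case empty
  then show ?case by auto
next
  case (insert w K)
  have op: "open (S - K)" by (intro open_Diff finite_imp_closed insert)
  have "S - K - {w} = S - insert w K" by blast
  then have "f holomorphic_on S - K - {w}"
    using insert.prems(3) by (simp only:)
  moreover have "w \<in> interior (S - K)" using op insert.hyps insert.prems(2) by (simp add: interior_open)
  ultimately obtain g where g: "g holomorphic_on S - K" "\<And>z. z \<in> S - K - {w} \<Longrightarrow> g z = f z"
    using holomorphic_on_extend_lim[of f "S - K" w] insert.prems(4)[of w] by blast
  have "((\<lambda>z. (z - v) * g z) \<longlongrightarrow> 0) (at v)" if v: "v \<in> K" for v
  proof -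
    have "open (S - K - {w} \<union> {v})"
    proof -
      have "S - K - {w} \<union> {v} = S - (insert w K - {v})" using v insert.hyps insert.prems(2) by blast
      moreover have "open (S - (insert w K - {v}))"
        using insert.hyps by (intro open_Diff insert.prems finite_imp_closed) auto
      ultimately show ?thesis by (simp only:)
    qed
    then have "eventually (\<lambda>z. z \<in> (S - K - {w} \<union> {v}) - {v}) (at v)"
      by (intro eventually_at_in_open) auto
    then have "eventually (\<lambda>z. (z - v) * f z = (z - v) * g z) (at v)"
      by eventually_elim (use g(2) in auto)
    then show ?thesis
      using insert.prems(4)[of v] v by (auto intro: Lim_transform_eventually)
  qed
  then obtain h where "h holomorphic_on S" "\<forall>z\<in>S - K. h z = g z"
    using insert.IH[OF insert.prems(1) _ g(1)] insert.prems(2) by auto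
  then show ?case using g(2) by (intro exI[of _ h]) auto
qed

lemma has_field_derivative_prod_powers:
  fixes z :: complex and m :: "complex \<Rightarrow> nat"
  assumes "finite K" "z \<notin> K"
  shows "((\<lambda>z. \<Prod>w\<in>K. (z - w) ^ m w) has_field_derivative
    (\<Prod>w\<in>K. (z - w) ^ m w) * (\<Sum>w\<in>K. of_nat (m w) / (z - w))) (at z)"
  using assms
proof (induction K rule: finite_induct)
  case empty
  then show ?case by simp
next
  case (insert v K)
  let ?P = "\<lambda>z. \<Prod>w\<in>K. (z - w) ^ m w" and ?S = "\<Sum>w\<in>K. of_nat (m w) / (z - w)"
  have zv: "z - v \<noteq> 0" using insert.prems by auto
  have "((\<lambda>z. (z - v) ^ m v) has_field_derivative (z - v) ^ m v * (of_nat (m v) / (z - v))) (at z)"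
  proof (cases "m v")
    case (Suc k)
    have "((\<lambda>z. (z - v) ^ Suc k) has_field_derivative of_nat (Suc k) * (z - v) ^ k) (at z)"
      by (auto intro!: derivative_eq_intros simp del: power_Suc of_nat_Suc)
    moreover have "(z - v) ^ Suc k * (of_nat (Suc k) / (z - v)) = of_nat (Suc k) * (z - v) ^ k"
      using zv by (simp del: of_nat_Suc)
    ultimately show ?thesis by (simp only: Suc)
  qed simp
  moreover have "(?P has_field_derivative ?P z * ?S) (at z)"
    using insert by auto
  ultimately have "((\<lambda>z. (z - v) ^ m v * ?P z) has_field_derivative
      (z - v) ^ m v * (of_nat (m v) / (z - v)) * ?P z + ?P z * ?S * (z - v) ^ m v) (at z)"
    by (rule DERIV_mult)
  moreover have "(z - v) ^ m v * (of_nat (m v) / (z - v)) * ?P z + ?P z * ?S * (z - v) ^ m v =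
      (z - v) ^ m v * ?P z * (of_nat (m v) / (z - v) + ?S)"
    by (simp only: distrib_left mult_ac)
  ultimately show ?case using insert.hyps by simp
qed

text \<open>The hypothesis makes each zero of s simple, and then 1 / s has a simple pole with
  residue 1 / s'(w) = \<open>m w\<close>. Subtracting these principal parts leaves removable
  singularities.\<close>

lemma log_derivative_regular_part:
  assumes s: "s holomorphic_on ball 0 1" "finite K" "K = {z \<in> ball 0 1. s z = 0}"
    and m: "\<And>w. w \<in> K \<Longrightarrow> of_nat (m w) * deriv s w = 1"
  obtains \<phi> where "\<phi> holomorphic_on ball 0 1"
    "\<And>z. z \<in> ball 0 1 - K \<Longrightarrow> \<phi> z = 1 / s z - (\<Sum>w\<in>K. of_nat (m w) / (z - w))"
proof -
  let ?f = "\<lambda>z. 1 / s z - (\<Sum>w\<in>K. of_nat (m w) / (z - w))"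
  have "((\<lambda>z. (z - v) * ?f z) \<longlongrightarrow> 0) (at v)" if v: "v \<in> K" for v
  proof -
    have v': "v \<in> ball 0 1" "s v = 0" using v s by auto
    have nz: "deriv s v \<noteq> 0" using m[OF v] by auto
    have "(s has_field_derivative deriv s v) (at v)"
      using s(1) v' holomorphic_derivI open_ball by blast
    then have "((\<lambda>z. s z / (z - v)) \<longlongrightarrow> deriv s v) (at v)"
      by (simp add: has_field_derivative_iff v')
    then have 1: "((\<lambda>z. inverse (s z / (z - v))) \<longlongrightarrow> inverse (deriv s v)) (at v)"
      using nz by (rule tendsto_inverse)
    have 2: "((\<lambda>z. \<Sum>w\<in>K - {v}. (z - v) * (of_nat (m w) / (z - w))) \<longlongrightarrow>
        (\<Sum>w\<in>K - {v}. (v - v) * (of_nat (m w) / (v - w)))) (at v)"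
      by (intro tendsto_sum tendsto_intros) auto
    have "((\<lambda>z. inverse (s z / (z - v)) - of_nat (m v) - (\<Sum>w\<in>K - {v}. (z - v) * (of_nat (m w) / (z - w)))) \<longlongrightarrow>
        inverse (deriv s v) - of_nat (m v) - (\<Sum>w\<in>K - {v}. (v - v) * (of_nat (m w) / (v - w)))) (at v)"
      by (intro tendsto_diff 1 2 tendsto_const)
    moreover have "inverse (deriv s v) = of_nat (m v)"
      using m[OF v] nz by (simp add: field_simps)
    ultimately have lim: "((\<lambda>z. inverse (s z / (z - v)) - of_nat (m v) -
        (\<Sum>w\<in>K - {v}. (z - v) * (of_nat (m w) / (z - w)))) \<longlongrightarrow> 0) (at v)"
      by simp
    have "eventually (\<lambda>z. z \<noteq> v) (at v)" by (simp add: eventually_at_filter)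
    then have "eventually (\<lambda>z. inverse (s z / (z - v)) - of_nat (m v) -
        (\<Sum>w\<in>K - {v}. (z - v) * (of_nat (m w) / (z - w))) = (z - v) * ?f z) (at v)"
    proof eventually_elim
      case (elim z)
      have "(\<Sum>w\<in>K. of_nat (m w) / (z - w)) = of_nat (m v) / (z - v) + (\<Sum>w\<in>K - {v}. of_nat (m w) / (z - w))"
        by (rule sum.remove[OF s(2) v])
      then have "(z - v) * ?f z = (z - v) / s z - ((z - v) * (of_nat (m v) / (z - v)) +
          (\<Sum>w\<in>K - {v}. (z - v) * (of_nat (m w) / (z - w))))"
        by (simp only: right_diff_distrib distrib_left sum_distrib_left) simp
      then show ?case using elim by (simp add: diff_diff_eq)
    qed
    with lim show ?thesis by (rule Lim_transform_eventually)
  qed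
  moreover have "?f holomorphic_on ball 0 1 - K"
    using s by (intro holomorphic_intros holomorphic_on_subset[OF s(1)]) auto
  ultimately have "\<exists>g. g holomorphic_on ball 0 1 \<and> (\<forall>z\<in>ball 0 1 - K. g z = ?f z)"
    using s by (intro removable_singularities_finite) auto
  then show ?thesis using that by blast
qed

text \<open>For a function defined only inside the disk but given, near the circle, by a formula g
  that is continuous up to it: compactness is applied to the inner disk with f and to the closed
  annulus with g.\<close>

lemma bounded_on_disk_split:
  fixes f g :: "complex \<Rightarrow> complex"
  assumes f: "continuous_on (ball 0 1) f" and \<rho>: "\<rho> < 1" and g: "continuous_on (cball 0 1 - ball 0 \<rho>) g"
    and eq: "\<And>z. z \<in> ball 0 1 - ball 0 \<rho> \<Longrightarrow> f z = g z"
  obtains B where "\<And>z. z \<in> ball 0 1 \<Longrightarrow> cmod (f z) \<le> B"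
proof -
  have "compact (f ` cball 0 \<rho>)"
    using \<rho> by (intro compact_continuous_image continuous_on_subset[OF f]) auto
  then obtain B1 where B1: "\<And>z. z \<in> cball 0 \<rho> \<Longrightarrow> cmod (f z) \<le> B1"
    using compact_imp_bounded bounded_iff by (metis imageI)
  have "compact (g ` (cball 0 1 - ball 0 \<rho>))"
    by (intro compact_continuous_image g compact_diff) auto
  then obtain B2 where B2: "\<And>z. z \<in> cball 0 1 - ball 0 \<rho> \<Longrightarrow> cmod (g z) \<le> B2"
    using compact_imp_bounded bounded_iff by (metis imageI)
  have "cmod (f z) \<le> max B1 B2" if "z \<in> ball 0 1" for z
  proof (cases "z \<in> ball 0 \<rho>")
    case True
    then show ?thesis using B1[of z] by auto
  next
    case False
    then show ?thesis using B2[of z] eq[of z] that by auto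
  qed
  then show ?thesis by (rule that)
qed

text \<open>The factor P is the exponential of the integrated principal parts of 1 / s, a polynomial
  because the residues are positive integers; H integrates the regular part. The regular part is
  bounded, hence so are H and F, and near the circle f = F / s is bounded because s does not vanish
  there.\<close>

lemma ode_bounded_solution:
  assumes s: "s holomorphic_on ball 0 1" "continuous_on (cball 0 1) s"
    and circle: "\<And>z. cmod z = 1 \<Longrightarrow> s z \<noteq> 0"
    and K: "finite K" "K = {z \<in> ball 0 1. s z = 0}"
    and m: "\<And>w. w \<in> K \<Longrightarrow> m w > 0 \<and> of_nat (m w) * deriv s w = 1"
  obtains F f B where "\<And>z. z \<in> ball 0 1 \<Longrightarrow> (F has_field_derivative f z) (at z)"
    "\<And>z. z \<in> ball 0 1 \<Longrightarrow> s z * f z = F z" "\<And>z. z \<in> ball 0 1 \<Longrightarrow> cmod (f z) \<le> B"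
    "\<exists>z\<in>ball 0 1. F z \<noteq> 0"
proof -
  obtain \<phi> where \<phi>: "\<phi> holomorphic_on ball 0 1"
    "\<And>z. z \<in> ball 0 1 - K \<Longrightarrow> \<phi> z = 1 / s z - (\<Sum>w\<in>K. of_nat (m w) / (z - w))"
    using log_derivative_regular_part[OF s(1) K, of m] m by blast
  \<comment> \<open>The radius \<rho> between M and 1 encloses all zeros of s, leaving a zero-free
    closed annulus. Inserting 0 keeps the maximum defined for empty K.\<close>
  define M where "M = Max (insert 0 (cmod ` K))"
  have "M < 1" unfolding M_def using K by (subst Max_less_iff) auto
  define \<rho> where "\<rho> = (M + 1) / 2"
  have \<rho>: "\<rho> < 1" "M < \<rho>" using \<open>M < 1\<close> by (auto simp: \<rho>_def)
  have "cmod w \<le> M" if "w \<in> K" for w unfolding M_def using K(1) that by (intro Max_ge) auto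
  then have K\<rho>: "K \<subseteq> ball 0 \<rho>" using \<rho> by force
  have s0: "s z \<noteq> 0" if "z \<in> cball 0 1 - ball 0 \<rho>" for z
  proof (cases "cmod z = 1")
    case False
    then have "z \<in> ball 0 1" "z \<notin> K" using that K\<rho> by auto
    then show ?thesis using K(2) by auto
  qed (rule circle)
  obtain B1 where B1: "\<And>z. z \<in> ball 0 1 \<Longrightarrow> cmod (\<phi> z) \<le> B1"
  proof (rule bounded_on_disk_split[OF holomorphic_on_imp_continuous_on[OF \<phi>(1)] \<rho>(1)])
    show "continuous_on (cball 0 1 - ball 0 \<rho>) (\<lambda>z. 1 / s z - (\<Sum>w\<in>K. of_nat (m w) / (z - w)))"
      using s0 K\<rho> by (intro continuous_intros continuous_on_subset[OF s(2)]) auto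
    show "\<phi> z = 1 / s z - (\<Sum>w\<in>K. of_nat (m w) / (z - w))" if "z \<in> ball 0 1 - ball 0 \<rho>" for z
      using that K\<rho> by (intro \<phi>(2)) auto
  qed blast
  obtain H where H: "\<And>z. z \<in> ball 0 1 \<Longrightarrow> (H has_field_derivative \<phi> z) (at z)" "H 0 = 0"
    using exists_primitive[OF \<phi>(1)] by blast
  have HB: "cmod (H z) \<le> B1" if z: "z \<in> ball 0 1" for z
  proof -
    have "cmod (H z - H 0) \<le> B1 * cmod (z - 0)"
    proof (rule field_differentiable_bound[OF convex_ball, of 0 1 H \<phi>])
      show "(H has_field_derivative \<phi> w) (at w within ball 0 1)" if "w \<in> ball 0 1" for w
        by (rule has_field_derivative_at_within[OF H(1)[OF that]])
    qed (use B1 z in auto)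
    also have "\<dots> \<le> B1 * 1"
      using z order_trans[OF norm_ge_zero B1[OF z]] by (intro mult_left_mono) auto
    finally show ?thesis by (simp add: H(2))
  qed
  define P where "P = (\<lambda>z. \<Prod>w\<in>K. (z - w) ^ m w)"
  define F where "F = (\<lambda>z. P z * exp (H z))"
  \<comment> \<open>Positive exponents make P vanish at every point of K, so that the equation also
    holds where s = 0.\<close>
  have P0: "P z = 0 \<longleftrightarrow> z \<in> K" for z
    unfolding P_def using K(1) m by (auto simp: prod_zero_iff)
  have "continuous_on (cball 0 1) P" unfolding P_def by (intro continuous_intros)
  then obtain B2 where B2: "\<And>z. z \<in> cball 0 1 \<Longrightarrow> cmod (P z) \<le> B2"
    using disk_algebra_bounded by blast
  have FB: "cmod (F z) \<le> B2 * exp B1" if z: "z \<in> ball 0 1" for z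
  proof -
    have "cmod (exp (H z)) \<le> exp B1"
      using HB[OF z] complex_Re_le_cmod[of "H z"] by (simp add: norm_exp_eq_Re)
    moreover have "cmod (P z) \<le> B2" using z by (intro B2) auto
    ultimately show ?thesis
      unfolding F_def norm_mult by (intro mult_mono) (auto intro: order_trans[OF norm_ge_zero])
  qed
  have "H holomorphic_on ball 0 1"
    using H holomorphic_on_open[OF open_ball] by blast
  then have Fh: "F holomorphic_on ball 0 1"
    unfolding F_def P_def by (intro holomorphic_intros)
  have ode: "s z * deriv F z = F z" if z: "z \<in> ball 0 1" for z
  proof (cases "z \<in> K")
    case True
    then have "s z = 0" "F z = 0" using K(2) P0[of z] by (auto simp: F_def)
    then show ?thesis by simp
  next
    case False
    then have "s z \<noteq> 0" using z K(2) by auto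
    have "((\<lambda>z. exp (H z)) has_field_derivative exp (H z) * \<phi> z) (at z)"
      by (rule DERIV_chain2[OF DERIV_exp H(1)[OF z]])
    from DERIV_mult[OF has_field_derivative_prod_powers[OF K(1) False, of m] this]
    have "(F has_field_derivative P z * (\<Sum>w\<in>K. of_nat (m w) / (z - w)) * exp (H z) + exp (H z) * \<phi> z * P z) (at z)"
      by (simp only: F_def P_def)
    moreover have "P z * (\<Sum>w\<in>K. of_nat (m w) / (z - w)) * exp (H z) + exp (H z) * \<phi> z * P z =
        F z * (1 / s z)"
    proof -
      have "\<phi> z = 1 / s z - (\<Sum>w\<in>K. of_nat (m w) / (z - w))"
        using z False by (intro \<phi>(2)) auto
      then have "1 / s z = (\<Sum>w\<in>K. of_nat (m w) / (z - w)) + \<phi> z" by simp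
      then show ?thesis unfolding F_def by (simp only: distrib_left mult_ac)
    qed
    ultimately have "deriv F z = F z * (1 / s z)" by (simp add: DERIV_imp_deriv)
    then show ?thesis using \<open>s z \<noteq> 0\<close> by simp
  qed
  have cont: "continuous_on (ball 0 1) (deriv F)"
    by (intro holomorphic_on_imp_continuous_on holomorphic_deriv[OF Fh] open_ball)
  have "continuous_on (cball 0 1 - ball 0 \<rho>) (\<lambda>z. 1 / s z)"
    using s0 by (intro continuous_intros continuous_on_subset[OF s(2)]) auto
  then have "compact ((\<lambda>z. 1 / s z) ` (cball 0 1 - ball 0 \<rho>))"
    by (intro compact_continuous_image compact_diff) auto
  then obtain B3 where B3: "\<And>z. z \<in> cball 0 1 - ball 0 \<rho> \<Longrightarrow> cmod (1 / s z) \<le> B3"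
    using compact_imp_bounded bounded_iff by (metis imageI)
  have "compact (deriv F ` cball 0 \<rho>)"
    using \<rho> by (intro compact_continuous_image continuous_on_subset[OF cont]) auto
  then obtain B4 where B4: "\<And>z. z \<in> cball 0 \<rho> \<Longrightarrow> cmod (deriv F z) \<le> B4"
    using compact_imp_bounded bounded_iff by (metis imageI)
  \<comment> \<open>On the inner disk compactness suffices; on the annulus the equation itself
    expresses the derivative as F / s.\<close>
  have bound: "cmod (deriv F z) \<le> max B4 (B3 * (B2 * exp B1))" if z: "z \<in> ball 0 1" for z
  proof (cases "z \<in> ball 0 \<rho>")
    case True
    then show ?thesis using B4[of z] by auto
  next
    case False
    then have z': "z \<in> cball 0 1 - ball 0 \<rho>" using z by auto
    have "deriv F z = 1 / s z * F z" using ode[OF z] s0[OF z'] by (simp add: field_simps)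
    then have "cmod (deriv F z) \<le> B3 * (B2 * exp B1)"
      using B3[OF z'] FB[OF z] unfolding norm_mult
      by (simp only: norm_mult) (intro mult_mono, auto intro: order_trans[OF norm_ge_zero])
    then show ?thesis by simp
  qed
  have "infinite (ball 0 1 :: complex set)" 
    using uncountable_ball[of 1 "0 :: complex"] countable_finite by auto
  then have "ball 0 1 - K \<noteq> {}" using K(1) by (metis finite_Diff2 finite.emptyI)
  then have "\<exists>z\<in>ball 0 1. F z \<noteq> 0" using P0 by (auto simp: F_def)
  then show ?thesis
    using that[of F "deriv F", OF _ ode bound] holomorphic_derivI[OF Fh open_ball] by blast
qed

lemma symbol_deriv:
  assumes p: "p holomorphic_on ball 0 1" and w: "w \<in> ball 0 1"
  shows "deriv (\<lambda>z. 1 + z * (p z - l)) w = p w - l + w * deriv p w"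
    and "deriv (\<lambda>z. z * (1 + z * (p z - l))) w = 1 + w * (p w - l) + w * (p w - l + w * deriv p w)"
proof -
  have "(p has_field_derivative deriv p w) (at w)"
    using p w holomorphic_derivI open_ball by blast
  then have "((\<lambda>z. 1 + z * (p z - l)) has_field_derivative p w - l + w * deriv p w) (at w)"
    and "((\<lambda>z. z * (1 + z * (p z - l))) has_field_derivative
      1 + w * (p w - l) + w * (p w - l + w * deriv p w)) (at w)"
    by (auto intro!: derivative_eq_intros simp: algebra_simps)
  then show "deriv (\<lambda>z. 1 + z * (p z - l)) w = p w - l + w * deriv p w"
    "deriv (\<lambda>z. z * (1 + z * (p z - l))) w = 1 + w * (p w - l) + w * (p w - l + w * deriv p w)"
    by (simp_all only: DERIV_imp_deriv)
qed

theorem theorem2p4: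
  fixes p :: "complex \<Rightarrow> complex" and l :: complex
  assumes "p holomorphic_on ball 0 1" and "continuous_on (cball 0 1) p"
    and "l \<notin> essential_spectrum_bergman (toeplitz (\<lambda>z. cnj z + p z))"
  shows "eigenvalue_bergman (toeplitz (\<lambda>z. cnj z + p z)) l \<longleftrightarrow>
    ({z \<in> ball 0 1. 1 + z * (p z - l) = 0} = {} \<or>
     (finite {z \<in> ball 0 1. 1 + z * (p z - l) = 0} \<and>
      (\<forall>w \<in> {z \<in> ball 0 1. 1 + z * (p z - l) = 0}.
         deriv (\<lambda>z. 1 + z * (p z - l)) w \<noteq> 0 \<and>
         (\<exists>n::nat. w\<^sup>2 * deriv p w = (of_nat n + 2) / (of_nat n + 1)))))"
proof -
  note p = assms(1,2)
  define q where "q = (\<lambda>z. 1 + z * (p z - l))"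
  define s where "s = (\<lambda>z. z * q z)"
  define Z where "Z = {z \<in> ball 0 1. q z = 0}"
  have circle: "q z \<noteq> 0" if "cmod z = 1" for z
    using fredholm_imp_symbol_nonzero[OF p _ that] assms(3) by (auto simp: essential_spectrum_bergman_def q_def)
  have q: "q holomorphic_on ball 0 1" "continuous_on (cball 0 1) q"
    unfolding q_def by (intro holomorphic_intros continuous_intros p)+
  have s: "s holomorphic_on ball 0 1" "continuous_on (cball 0 1) s"
    unfolding s_def by (intro holomorphic_intros continuous_intros q)+
  have "finite Z" unfolding Z_def
    by (rule finite_zeros_disk[OF q circle, of 0]) (auto simp: q_def)
  \<comment> \<open>At a zero of q the relation w (p(w) - l) = -1 eliminates l. Combined with s'(w)
    = w q'(w), it ties the condition of the theorem to the derivative of the coefficient s.\<close>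
  have wq: "w * deriv q w = w\<^sup>2 * deriv p w - 1" if "w \<in> Z" for w
  proof -
    have "w * (p w - l) = -1" using that by (simp add: Z_def q_def add_eq_0_iff)
    moreover have "deriv q w = p w - l + w * deriv p w"
      using that symbol_deriv(1)[OF p(1), of w l] by (simp add: Z_def q_def)
    then have "w * deriv q w = w * (p w - l) + w\<^sup>2 * deriv p w"
      by (simp add: power2_eq_square distrib_left)
    ultimately show ?thesis by simp
  qed
  have ds: "deriv s w = w * deriv q w" if "w \<in> Z" for w
    using that symbol_deriv[OF p(1), of w l] by (simp add: Z_def s_def q_def)
  have ds0: "deriv s 0 = 1"
    using symbol_deriv(2)[OF p(1), of 0 l] by (simp add: s_def q_def)
  have Z0: "0 \<notin> Z" by (simp add: Z_def q_def)
  have "eigenvalue_bergman (toeplitz (\<lambda>z. cnj z + p z)) l \<longleftrightarrow>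
    (\<forall>w\<in>Z. deriv q w \<noteq> 0 \<and> (\<exists>n::nat. w\<^sup>2 * deriv p w = (of_nat n + 2) / (of_nat n + 1)))"
  proof
    assume "eigenvalue_bergman (toeplitz (\<lambda>z. cnj z + p z)) l"
    then obtain f z0 where f: "f \<in> bergman" "z0 \<in> ball 0 1" "f z0 \<noteq> 0"
      and ev: "\<forall>z\<in>ball 0 1. toeplitz (\<lambda>z. cnj z + p z) f z = l * f z"
      by (auto simp: eigenvalue_bergman_def)
    obtain F where F: "\<And>z. z \<in> ball 0 1 \<Longrightarrow> (F has_field_derivative f z) (at z)" "F 0 = 0"
      using exists_primitive[OF bergmanD(1)[OF f(1)]] by blast
    have ode: "\<And>z. z \<in> ball 0 1 \<Longrightarrow> s z * f z = F z"
      using ev eigenfunction_iff_ode[OF p f(1) F, of l] unfolding s_def q_def by blast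
    have "\<exists>z\<in>ball 0 1. F z \<noteq> 0"
    proof (rule ccontr)
      assume "\<not> (\<exists>z\<in>ball 0 1. F z \<noteq> 0)"
      then have "(F has_field_derivative 0) (at z0)"
        by (intro has_field_derivative_transform_within_open[OF DERIV_const open_ball f(2)]) auto
      with F(1)[OF f(2)] f(3) show False by (metis DERIV_unique)
    qed
    then obtain z1 where z1: "z1 \<in> ball 0 1" "F z1 \<noteq> 0" by blast
    show "\<forall>w\<in>Z. deriv q w \<noteq> 0 \<and> (\<exists>n::nat. w\<^sup>2 * deriv p w = (of_nat n + 2) / (of_nat n + 1))"
    proof
      fix w assume w: "w \<in> Z"
      then have w': "w \<in> ball 0 1" "s w = 0" by (auto simp: Z_def s_def)
      obtain n :: nat where n: "n > 0" "of_nat n * deriv s w = 1"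
        using ode_zero_order[OF F(1) ode s(1) w' z1] by blast
      \<comment> \<open>The vanishing order n is at least 1, and k = n - 1 is the integer of the
        theorem: 1 + 1 / (k + 1) = (k + 2) / (k + 1).\<close>
      obtain k where k: "n = Suc k" using n gr0_implies_Suc by blast
      have k1: "of_nat k + 1 \<noteq> (0 :: complex)" by (metis of_nat_Suc of_nat_eq_0_iff add.commute Zero_not_Suc)
      have "(of_nat k + 1) * (w\<^sup>2 * deriv p w - 1) = 1"
        using n(2) by (simp add: ds[OF w] wq[OF w] k add.commute)
      then have "w\<^sup>2 * deriv p w = (of_nat k + 2) / (of_nat k + 1)"
        using k1 by (simp add: field_simps)
      moreover have "deriv q w \<noteq> 0" using n(2) ds[OF w] by auto
      ultimately show "deriv q w \<noteq> 0 \<and> (\<exists>n::nat. w\<^sup>2 * deriv p w = (of_nat n + 2) / (of_nat n + 1))"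
        by blast
    qed
  next
    assume R: "\<forall>w\<in>Z. deriv q w \<noteq> 0 \<and> (\<exists>n::nat. w\<^sup>2 * deriv p w = (of_nat n + 2) / (of_nat n + 1))"
    \<comment> \<open>The coefficient s vanishes at the origin as well; its exponent there is 1
      because s'(0) = 1. A zero of q with integer n receives the exponent n + 1.\<close>
    define K where "K = insert 0 Z"
    have K: "finite K" "K = {z \<in> ball 0 1. s z = 0}"
      using \<open>finite Z\<close> by (auto simp: K_def Z_def s_def)
    have "\<forall>w\<in>K. \<exists>m::nat. m > 0 \<and> of_nat m * deriv s w = 1"
    proof
      fix w assume "w \<in> K"
      then consider "w = 0" | "w \<in> Z" by (auto simp: K_def)
      then show "\<exists>m::nat. m > 0 \<and> of_nat m * deriv s w = 1"
      proof cases
        case 1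
        then show ?thesis using ds0 by (intro exI[of _ 1]) simp
      next
        case 2
        then obtain n :: nat where n: "w\<^sup>2 * deriv p w = (of_nat n + 2) / (of_nat n + 1)"
          using R by blast
        have n1: "of_nat n + 1 \<noteq> (0 :: complex)" by (metis of_nat_Suc of_nat_eq_0_iff add.commute Zero_not_Suc)
        have "deriv s w = (of_nat n + 2) / (of_nat n + 1) - 1"
          by (simp add: ds[OF 2] wq[OF 2] n)
        then have "(of_nat n + 1) * deriv s w = 1" using n1 by (simp add: field_simps)
        then show ?thesis by (intro exI[of _ "Suc n"]) (simp add: add.commute)
      qed
    qed
    then obtain m :: "complex \<Rightarrow> nat" where m: "\<And>w. w \<in> K \<Longrightarrow> m w > 0 \<and> of_nat (m w) * deriv s w = 1"
      by metis
    have "s z \<noteq> 0" if "cmod z = 1" for z using circle[OF that] that by (auto simp: s_def)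
    then obtain F f B where F: "\<And>z. z \<in> ball 0 1 \<Longrightarrow> (F has_field_derivative f z) (at z)"
      and ode: "\<And>z. z \<in> ball 0 1 \<Longrightarrow> s z * f z = F z" and B: "\<And>z. z \<in> ball 0 1 \<Longrightarrow> cmod (f z) \<le> B"
      and nz: "\<exists>z\<in>ball 0 1. F z \<noteq> 0"
      using ode_bounded_solution[OF s _ K m] by blast
    \<comment> \<open>Nothing is known about f off the disk, while \<open>bergman\<close> prescribes
      the value 0 there.\<close>
    define f0 where "f0 = (\<lambda>z. if z \<in> ball 0 1 then f z else 0)"
    have F': "\<And>z. z \<in> ball 0 1 \<Longrightarrow> (F has_field_derivative f0 z) (at z)"
      using F by (simp add: f0_def)
    have F0: "F 0 = 0" using ode[of 0] by (simp add: s_def)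
    have "F holomorphic_on ball 0 1" using F holomorphic_on_open[OF open_ball] by blast
    then have "deriv F holomorphic_on ball 0 1" by (rule holomorphic_deriv) simp
    then have hol: "f0 holomorphic_on ball 0 1"
      by (rule holomorphic_transform) (use DERIV_imp_deriv[OF F] in \<open>simp add: f0_def\<close>)
    have f0: "f0 \<in> bergman"
    proof (rule bergmanI[OF hol])
      note [measurable] = holomorphic_measurable_dA[OF hol]
      show "integrable dA (\<lambda>z. (cmod (f0 z))\<^sup>2)"
      proof (rule dA.integrable_const_bound[where B = "B\<^sup>2"])
        show "AE z in dA. norm ((cmod (f0 z))\<^sup>2) \<le> B\<^sup>2"
          by (rule AE_I2) (use B in \<open>auto simp: f0_def intro!: power_mono\<close>)
      qed measurable
    qed (auto simp: f0_def)
    have "\<forall>z\<in>ball 0 1. toeplitz (\<lambda>z. cnj z + p z) f0 z = l * f0 z"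
    proof -
      have "\<forall>z\<in>ball 0 1. z * (1 + z * (p z - l)) * f0 z = F z"
        using ode by (simp add: f0_def s_def q_def)
      then show ?thesis using eigenfunction_iff_ode[OF p f0 F' F0, of l] by blast
    qed
    moreover have "\<exists>z\<in>ball 0 1. f0 z \<noteq> 0"
      using nz ode by (metis f0_def mult_zero_right)
    ultimately show "eigenvalue_bergman (toeplitz (\<lambda>z. cnj z + p z)) l"
      using f0 by (auto simp: eigenvalue_bergman_def)
  qed
  \<comment> \<open>For empty Z the condition over Z holds vacuously, so the equivalence just shown
    covers both alternatives of the statement.\<close>
  then show ?thesis
    using \<open>finite Z\<close> unfolding Z_def q_def by blast
qed

end
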